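(* Let $\psi_w(i,j)=2^{ij}$ for integers $i,j\ge 1$. (1) Let $r\ge 1$ be an integer. Let $V_r=\begin{bmatrix}\sqrt{x^1/1!} & \cdots & \sqrt{x^r/r!}\end{bmatrix}^T$, let $D_r$ be the $r\times r$ diagonal matrix whose diagonal entries are those of $V_r$, and let $A_r$ be the $r\times r$ matrix with $(i,j)$-entry $\psi_w(i,j)$. Then the exponential generating function of the number of weakly graded posets on $[n]$ of height $k$ with at most $r$ vertices on each rank is $V_r^T(D_rA_rD_r)^{k-1}V_r$, and the exponential generating function of the number of weakly graded posets on $[n]$ with at most $r$ vertices on each rank is $V_r^T(I_r-D_rA_rD_r)^{-1}V_r$. (2) With $V$, $D$, $A$ the infinite limits of $V_r$, $D_r$, $A_r$ (entries formal power series), the exponential generating function for the number of weakly graded posets on $n$ labeled vertices is $V^T(I-DAD)^{-1}V$.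
   Context: All posets are finite; $x$ covers $y$ if $y<x$ and no $z$ satisfies $y<z<x$. A weakly graded poset is a poset $P$ equipped with a rank function $r:P\to\mathbb{Z}$ such that whenever $x$ covers $y$, $r(x)-r(y)=1$; rank functions differing by a global additive constant are identified. A weakly graded poset has height $k$ if (after translation) its rank function takes exactly the values $0,1,\dots,k-1$; the vertices of each value form a rank. Two weakly graded posets on the same labeled set are distinct if either the order or the (translation class of the) rank function differs. The exponential generating function of $e_n$ is $\sum_n e_n x^n/n!$.
   Formalization: Where the height is not prescribed, only weakly graded posets of some height k ≥ 1 are counted: rank functions with gaps (infinitely many already on a two-element antichain) and the empty poset (the matrix formulas have zero constant term) are excluded. *)

theory Defs
  imports
    "HOL-Library.FuncSet"
    "HOL-Computational_Algebra.Formal_Power_Series"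
    "Jordan_Normal_Form.Matrix"
begin

section \<open>Weakly graded posets\<close>

text \<open>A partial order is a set of pairs; \<open>(x, y) \<in> R\<close> means \<open>x \<le> y\<close>.\<close>

definition covers :: "('a \<times> 'a) set \<Rightarrow> 'a \<Rightarrow> 'a \<Rightarrow> bool" where
  "covers R x y \<longleftrightarrow>
     (y, x) \<in> R \<and> y \<noteq> x \<and>
     \<not> (\<exists>z. (y, z) \<in> R \<and> y \<noteq> z \<and> (z, x) \<in> R \<and> z \<noteq> x)"

definition rank_functions :: "'a set \<Rightarrow> ('a \<times> 'a) set \<Rightarrow> ('a \<Rightarrow> int) set" where
  "rank_functions S R =
     {\<rho> \<in> S \<rightarrow>\<^sub>E UNIV. \<forall>x\<in>S. \<forall>y\<in>S. covers R x y \<longrightarrow> \<rho> x - \<rho> y = 1}"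

definition translation_rel :: "'a set \<Rightarrow> (('a \<Rightarrow> int) \<times> ('a \<Rightarrow> int)) set" where
  "translation_rel S =
     {(\<rho>, \<sigma>). \<rho> \<in> S \<rightarrow>\<^sub>E UNIV \<and> \<sigma> \<in> S \<rightarrow>\<^sub>E UNIV \<and> (\<exists>c. \<forall>v\<in>S. \<sigma> v = \<rho> v + c)}"

text \<open>A weakly graded poset on \<open>S\<close> is a pair consisting of an order and a translation class
  of rank functions.\<close>

type_synonym 'a wg_poset = "('a \<times> 'a) set \<times> ('a \<Rightarrow> int) set"

definition wg_posets :: "'a set \<Rightarrow> 'a wg_poset set" where
  "wg_posets S =
     {(R, C). partial_order_on S R \<and> C \<in> rank_functions S R // translation_rel S}"

definition has_height :: "'a set \<Rightarrow> nat \<Rightarrow> 'a wg_poset \<Rightarrow> bool" where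
  "has_height S k P \<longleftrightarrow> (\<exists>\<rho> \<in> snd P. \<rho> ` S = {0..<int k})"

definition ranks_at_most :: "'a set \<Rightarrow> nat \<Rightarrow> 'a wg_poset \<Rightarrow> bool" where
  "ranks_at_most S r P \<longleftrightarrow> (\<forall>\<rho> \<in> snd P. \<forall>c. card {v \<in> S. \<rho> v = c} \<le> r)"

text \<open>Rank functions with gaps are allowed in \<open>wg_posets\<close> (an antichain with at least two
  elements has infinitely many of them), and such posets have no height. The posets that are
  counted without prescribing the height are those that have some height \<open>k \<ge> 1\<close>; the bound
  \<open>k \<ge> 1\<close> leaves out the empty poset, in accordance with the vanishing constant term of the
  generating functions.\<close>

definition num_height_bounded :: "nat \<Rightarrow> nat \<Rightarrow> nat \<Rightarrow> nat" where
  "num_height_bounded r k n =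
     card {P \<in> wg_posets {1..n}. has_height {1..n} k P \<and> ranks_at_most {1..n} r P}"

definition num_bounded :: "nat \<Rightarrow> nat \<Rightarrow> nat" where
  "num_bounded r n =
     card {P \<in> wg_posets {1..n}. (\<exists>k\<ge>1. has_height {1..n} k P) \<and> ranks_at_most {1..n} r P}"

definition num_all :: "nat \<Rightarrow> nat" where
  "num_all n = card {P \<in> wg_posets {1..n}. \<exists>k\<ge>1. has_height {1..n} k P}"


section \<open>Generating functions\<close>

text \<open>The entries of \<open>V\<close> involve square roots of \<open>x\<close>, so all series are series in a variable
  \<open>t\<close> (the library's \<open>fps_X\<close>) with \<open>x = t\<^sup>2\<close>, and generating functions in \<open>x\<close> are
  substituted accordingly.\<close>

definition x_var :: "real fps" where
  "x_var = fps_X ^ 2"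

definition egf :: "(nat \<Rightarrow> nat) \<Rightarrow> real fps" where
  "egf e = Abs_fps (\<lambda>n. real (e n) / fact n)"

definition egf_x :: "(nat \<Rightarrow> nat) \<Rightarrow> real fps" where
  "egf_x e = fps_compose (egf e) x_var"

definition sqrt_term :: "nat \<Rightarrow> real fps" where
  "sqrt_term i = fps_const (1 / sqrt (fact i)) * fps_X ^ i"

lemma sqrt_term_squared: "sqrt_term i ^ 2 = fps_const (1 / fact i) * x_var ^ i"
  by (simp add: sqrt_term_def x_var_def power_mult_distrib fps_const_power power_divide
      mult.commute flip: power_mult)

definition psi_w :: "nat \<Rightarrow> nat \<Rightarrow> nat" where
  "psi_w i j = 2 ^ (i * j)"


section \<open>Finite matrices\<close>

text \<open>Indices in the library start at \<open>0\<close>: the index \<open>i\<close> stands for the \<open>(i+1)\<close>-st row or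
  column.\<close>

definition V_fin :: "nat \<Rightarrow> real fps vec" where
  "V_fin r = vec r (\<lambda>i. sqrt_term (Suc i))"

definition D_fin :: "nat \<Rightarrow> real fps mat" where
  "D_fin r = mat_diag r (\<lambda>i. sqrt_term (Suc i))"

definition A_fin :: "nat \<Rightarrow> real fps mat" where
  "A_fin r = mat r r (\<lambda>(i, j). of_nat (psi_w (Suc i) (Suc j)))"

definition mat_inv_of :: "'a::semiring_1 mat \<Rightarrow> 'a mat" where
  "mat_inv_of M = (THE B. inverts_mat M B \<and> inverts_mat B M)"


section \<open>Infinite matrices\<close>

text \<open>Sums over infinite index sets are taken in the library's topology on formal power
  series, in which convergence is coefficientwise eventual constancy. The index conventions
  are those of the finite case, so \<open>V_inf\<close>, \<open>D_inf\<close>, \<open>A_inf\<close> are the entrywise limits of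
  \<open>V_fin r\<close>, \<open>D_fin r\<close>, \<open>A_fin r\<close>.\<close>

type_synonym inf_vec = "nat \<Rightarrow> real fps"
type_synonym inf_mat = "nat \<Rightarrow> nat \<Rightarrow> real fps"

definition V_inf :: inf_vec where
  "V_inf i = sqrt_term (Suc i)"

definition D_inf :: inf_mat where
  "D_inf i j = (if i = j then sqrt_term (Suc i) else 0)"

definition A_inf :: inf_mat where
  "A_inf i j = of_nat (psi_w (Suc i) (Suc j))"

definition inf_one :: inf_mat where
  "inf_one i j = (if i = j then 1 else 0)"

definition inf_minus :: "inf_mat \<Rightarrow> inf_mat \<Rightarrow> inf_mat" where
  "inf_minus M N i j = M i j - N i j"

definition inf_mult :: "inf_mat \<Rightarrow> inf_mat \<Rightarrow> inf_mat" where
  "inf_mult M N i j = (\<Sum>k. M i k * N k j)"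

definition inf_mult_vec :: "inf_mat \<Rightarrow> inf_vec \<Rightarrow> inf_vec" where
  "inf_mult_vec M v i = (\<Sum>j. M i j * v j)"

definition inf_inverse_of :: "inf_mat \<Rightarrow> inf_mat \<Rightarrow> bool" where
  "inf_inverse_of M B \<longleftrightarrow>
     (\<forall>i j. summable (\<lambda>k. M i k * B k j) \<and> summable (\<lambda>k. B i k * M k j)) \<and>
     inf_mult M B = inf_one \<and> inf_mult B M = inf_one"

definition inf_inv :: "inf_mat \<Rightarrow> inf_mat" where
  "inf_inv M = (THE B. inf_inverse_of M B)"

lemma V_inf_limit: "i < r \<Longrightarrow> V_fin r $ i = V_inf i"
  by (simp add: V_fin_def V_inf_def)

lemma D_inf_limit: "i < r \<Longrightarrow> j < r \<Longrightarrow> D_fin r $$ (i, j) = D_inf i j"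
  by (simp add: D_fin_def D_inf_def mat_diag_def)

lemma A_inf_limit: "i < r \<Longrightarrow> j < r \<Longrightarrow> A_fin r $$ (i, j) = A_inf i j"
  by (simp add: A_fin_def A_inf_def)

end

(* A weakly graded poset of height k is the same as a surjective rank function onto {0..<k} together
   with an arbitrary set of pairs between consecutive ranks: these pairs are exactly the covering
   pairs of the order that they generate. Hence rank sizes n_1, ..., n_k contribute a multinomial
   coefficient times the product of the 2^(n_i n_(i+1)), and splitting off the bottom rank turns
   the count into iteration of the transfer matrix N = DAD.

   All entries of row i and of column i of N have order greater than i, so every coefficient of
   a sum over matrix indices is a finite sum. The inverse of I - N is the Neumann series: x = v + N x has
   exactly one solution, because coefficient n of N x only depends on lower coefficients of x.
   The finite matrices are truncations of the infinite one. *)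

theory Submission
  imports Defs
begin

text \<open>The obstacle is the identity matrix. A diagonal 1 at a large index keeps a nonzero
  constant coefficient, so the rows of I - N and of its inverse escape the bound that makes sums
  finite, and associativity of infinite products cannot be taken for granted. Sums involving the
  identity are therefore split into a bounded family plus one single term, powers of N occur only as
  iterated actions on vectors, and the left inverse property is deduced from uniqueness of the
  solution of x = v + N x. The square roots are harmless because component i of a vector is read
  only after multiplication by its own weight: the two roots that belong to the bottom rank combine
  to x^s / s! with s = i + 1, and what remains is again a component multiplied by its
  weight.\<close>

section \<open>Infinite matrices over formal power series\<close>

text \<open>Coefficient \<open>n\<close> of the sum of such a family only involves the terms with index at
  most \<open>n\<close>.\<close>

definition null_family :: "(nat \<Rightarrow> 'a::comm_ring_1 fps) \<Rightarrow> bool" where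
  "null_family a \<longleftrightarrow> (\<forall>j n. n < j \<longrightarrow> fps_nth (a j) n = 0)"

lemma null_familyD: "null_family a \<Longrightarrow> n < j \<Longrightarrow> fps_nth (a j) n = 0"
  by (simp add: null_family_def)

lemma null_family_mult_left: "null_family a \<Longrightarrow> null_family (\<lambda>j. c j * a j)"
  unfolding null_family_def fps_mult_nth by (auto intro!: sum.neutral)

lemma null_family_mult_right: "null_family a \<Longrightarrow> null_family (\<lambda>j. a j * c j)"
  using null_family_mult_left[of a c] by (simp add: mult.commute)

text \<open>In a row of I - N the diagonal 1 violates the bound of a null family. Here it is the
  summand \<open>b\<close> at position \<open>i\<close>; past \<open>max n i\<close>, coefficient
  \<open>n\<close> of the partial sums no longer changes.\<close>

lemma null_family_add_delta_sums:
  assumes "null_family a"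
  shows "(\<lambda>j. a j + (if j = i then b else 0)) sums
           (Abs_fps (\<lambda>n. \<Sum>j\<le>n. fps_nth (a j) n) + b)"
  unfolding sums_def
proof (rule tendsto_fpsI)
  fix n
  have "fps_nth (\<Sum>j<m. a j + (if j = i then b else 0)) n =
        fps_nth (Abs_fps (\<lambda>n. \<Sum>j\<le>n. fps_nth (a j) n) + b) n" if "m > max n i" for m
  proof -
    have "(\<Sum>j<m. fps_nth (a j) n) = (\<Sum>j\<le>n. fps_nth (a j) n)"
      using that assms by (intro sum.mono_neutral_right) (auto simp: null_family_def)
    moreover have "(\<Sum>j<m. if j = i then b else 0) = b"
      using that by simp
    ultimately show ?thesis
      by (simp add: sum.distrib fps_sum_nth)
  qed
  then show "\<forall>\<^sub>F m in sequentially. fps_nth (\<Sum>j<m. a j + (if j = i then b else 0)) n =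
        fps_nth (Abs_fps (\<lambda>n. \<Sum>j\<le>n. fps_nth (a j) n) + b) n"
    using eventually_gt_at_top by (rule eventually_mono[rotated])
qed

lemma null_family_sums:
  "null_family a \<Longrightarrow> a sums Abs_fps (\<lambda>n. \<Sum>j\<le>n. fps_nth (a j) n)"
  using null_family_add_delta_sums[of a 0 0] by simp

lemma null_family_summable: "null_family a \<Longrightarrow> summable a"
  by (rule sums_summable[OF null_family_sums])

lemma null_family_add_delta_sums':
  "null_family a \<Longrightarrow> (\<lambda>j. a j + (if j = i then b else 0)) sums (suminf a + b)"
  using null_family_add_delta_sums[of a i b] sums_unique[OF null_family_sums, of a] by simp

text \<open>The free cutoff \<open>m\<close> lets several series be expanded over one common index
  range, as is required when finite sums are interchanged or an index is shifted.\<close>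

lemma null_family_suminf_nth:
  assumes "null_family a" "n \<le> m"
  shows "fps_nth (suminf a) n = (\<Sum>j\<le>m. fps_nth (a j) n)"
proof -
  have "fps_nth (suminf a) n = (\<Sum>j\<le>n. fps_nth (a j) n)"
    by (simp flip: sums_unique[OF null_family_sums[OF assms(1)]])
  also have "\<dots> = (\<Sum>j\<le>m. fps_nth (a j) n)"
    using assms by (intro sum.mono_neutral_left) (auto simp: null_family_def)
  finally show ?thesis .
qed

lemma null_family_suminf_mult:
  assumes "null_family a"
  shows "c * suminf a = (\<Sum>j. c * a j)"
proof (rule fps_ext)
  fix n
  have "fps_nth (c * suminf a) n = (\<Sum>i=0..n. fps_nth c i * (\<Sum>j\<le>n. fps_nth (a j) (n - i)))"
    by (simp add: fps_mult_nth null_family_suminf_nth[OF assms, of _ n])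
  also have "\<dots> = (\<Sum>j\<le>n. fps_nth (c * a j) n)"
    by (simp add: fps_mult_nth sum_distrib_left sum.swap[of _ "{0..n}"])
  also have "\<dots> = fps_nth (\<Sum>j. c * a j) n"
    using null_family_suminf_nth[OF null_family_mult_left[OF assms, of "\<lambda>_. c"] order_refl, of n] by simp
  finally show "fps_nth (c * suminf a) n = fps_nth (\<Sum>j. c * a j) n" .
qed

lemma null_family_suminf:
  assumes "\<And>j. null_family (a j)" "\<And>k. null_family (\<lambda>j. a j k)"
  shows "null_family (\<lambda>j. suminf (a j))"
  unfolding null_family_def
proof (intro allI impI)
  fix j n :: nat
  assume "n < j"
  then show "fps_nth (suminf (a j)) n = 0"
    using null_familyD[OF assms(2)] by (simp add: null_family_suminf_nth[OF assms(1) order_refl])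
qed

text \<open>Since the order grows in each index separately, coefficient \<open>n\<close> of either
  iterated sum is a sum over the square of indices up to \<open>n\<close>.\<close>

lemma null_family_suminf_swap:
  assumes "\<And>j. null_family (a j)" "\<And>k. null_family (\<lambda>j. a j k)"
  shows "(\<Sum>j. \<Sum>k. a j k) = (\<Sum>k. \<Sum>j. a j k)"
proof (rule fps_ext)
  fix n
  have "null_family (\<lambda>j. \<Sum>k. a j k)" "null_family (\<lambda>k. \<Sum>j. a j k)"
    using null_family_suminf[of a] null_family_suminf[of "\<lambda>k j. a j k"] assms by auto
  then show "fps_nth (\<Sum>j. \<Sum>k. a j k) n = fps_nth (\<Sum>k. \<Sum>j. a j k) n"
    using assms sum.swap[of "\<lambda>j k. fps_nth (a j k) n" "{..n}" "{..n}"]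
    by (simp add: null_family_suminf_nth[OF _ order_refl])
qed

lemma null_family_suminf_add:
  assumes "null_family a" "null_family b"
  shows "(\<Sum>j. a j + b j) = suminf a + suminf b"
proof (rule fps_ext)
  fix n
  have "null_family (\<lambda>j. a j + b j)"
    using assms by (simp add: null_family_def)
  then show "fps_nth (\<Sum>j. a j + b j) n = fps_nth (suminf a + suminf b) n"
    using assms by (simp add: null_family_suminf_nth[OF _ order_refl] sum.distrib)
qed

lemma null_family_suminf_split_head:
  assumes "null_family a"
  shows "suminf a = a 0 + (\<Sum>j. a (Suc j))"
proof (rule fps_ext)
  fix n
  have "null_family (\<lambda>j. a (Suc j))"
    using assms by (simp add: null_family_def)
  then show "fps_nth (suminf a) n = fps_nth (a 0 + (\<Sum>j. a (Suc j))) n"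
    by (simp add: null_family_suminf_nth[OF assms, of n "Suc n"] null_family_suminf_nth[OF _ order_refl]
        sum.atMost_Suc_shift del: sum.atMost_Suc)
qed

section \<open>Neumann series and resolvent of a matrix with entries of growing order\<close>

lemma suminf_delta:
  fixes c :: "nat \<Rightarrow> 'a::{comm_monoid_add, t2_space}"
  shows "(\<Sum>k. if k = i then c k else 0) = c i"
  using sums_single[of i c] by (simp add: sums_iff)

text \<open>The bound \<open>n \<le> i\<close> is one stronger than null families require: it forces
  a zero constant coefficient in every entry, including the one at (0, 0). This makes multiplication
  by N a contraction.\<close>

locale null_matrix =
  fixes N :: "nat \<Rightarrow> nat \<Rightarrow> 'a::comm_ring_1 fps"
  assumes nth_eq_0: "n \<le> i \<or> n \<le> j \<Longrightarrow> fps_nth (N i j) n = 0"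
begin

lemma null_row: "null_family (\<lambda>j. N i j)" and null_column: "null_family (\<lambda>i. N i j)"
  by (auto simp: null_family_def nth_eq_0)

definition act :: "(nat \<Rightarrow> 'a fps) \<Rightarrow> nat \<Rightarrow> 'a fps" where
  "act v i = (\<Sum>j. N i j * v j)"

lemma null_act: "null_family (\<lambda>j. N i j * v j)"
  by (rule null_family_mult_right[OF null_row])

lemma act_add: "act (\<lambda>j. u j + v j) i = act u i + act v i"
  unfolding act_def by (simp add: distrib_left null_family_suminf_add null_act)

lemma act_unit: "act (\<lambda>i. if i = j then 1 else 0) i = N i j"
  unfolding act_def using suminf_delta[of j "N i"] by (simp add: if_distrib cong: if_cong)

lemma act_nth_cong:
  assumes "\<And>j m. m < n \<Longrightarrow> fps_nth (u j) m = fps_nth (v j) m"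
  shows "fps_nth (act u i) n = fps_nth (act v i) n"
proof -
  have "fps_nth (N i j * u j) n = fps_nth (N i j * v j) n" for j
    unfolding fps_mult_nth
  proof (rule sum.cong)
    \<comment> \<open>The term \<open>m = 0\<close> disappears with the constant coefficient of
      \<open>N i j\<close>; every other term reads \<open>u\<close> and \<open>v\<close> below
      \<open>n\<close>.\<close>
    fix m assume "m \<in> {0..n}"
    then show "fps_nth (N i j) m * fps_nth (u j) (n - m) = fps_nth (N i j) m * fps_nth (v j) (n - m)"
      using assms[of "n - m" j] nth_eq_0[of m i j] by (cases "m = 0") auto
  qed simp
  then show ?thesis
    by (simp add: act_def null_family_suminf_nth[OF null_act order_refl])
qed

lemma act_pow_nth_eq_0: "n < k \<Longrightarrow> fps_nth ((act ^^ k) v i) n = 0"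
proof (induction k arbitrary: n i)
  case (Suc k)
  \<comment> \<open>By induction \<open>(act ^^ k) v\<close> agrees with the zero vector below
    \<open>n\<close>, so it may be replaced by zero.\<close>
  then have "fps_nth (act ((act ^^ k) v) i) n = fps_nth (act (\<lambda>_. 0) i) n"
    by (intro act_nth_cong) simp
  then show ?case by (simp add: act_def[of "\<lambda>_. 0"])
qed simp

lemma null_act_pow: "null_family (\<lambda>k. (act ^^ k) v i)"
  by (simp add: null_family_def act_pow_nth_eq_0)

definition sol :: "(nat \<Rightarrow> 'a fps) \<Rightarrow> nat \<Rightarrow> 'a fps" where
  "sol v i = (\<Sum>k. (act ^^ k) v i)"

lemma sol_eq: "sol v i = v i + act (sol v) i"
proof -
  have "act (sol v) i = (\<Sum>j. \<Sum>k. N i j * (act ^^ k) v j)"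
    by (simp add: act_def sol_def null_family_suminf_mult null_act_pow)
  also have "\<dots> = (\<Sum>k. \<Sum>j. N i j * (act ^^ k) v j)"
    by (intro null_family_suminf_swap null_family_mult_left null_act_pow null_act)
  also have "\<dots> = (\<Sum>k. (act ^^ Suc k) v i)"
    by (simp add: act_def)
  finally show ?thesis
    by (simp add: sol_def null_family_suminf_split_head[OF null_act_pow[of v i]])
qed

lemma sol_unique:
  assumes "\<And>i. x i = v i + act x i"
  shows "x i = sol v i"
proof (rule fps_ext)
  show "fps_nth (x i) n = fps_nth (sol v i) n" for n
  proof (induction n arbitrary: i rule: less_induct)
    case (less n)
    have "fps_nth (act x i) n = fps_nth (act (sol v) i) n"
      by (rule act_nth_cong) (rule less)
    then show ?case
      using arg_cong[OF assms[of i], of "\<lambda>f. fps_nth f n"] arg_cong[OF sol_eq[of v i], of "\<lambda>f. fps_nth f n"]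
      by simp
  qed
qed

text \<open>Column \<open>j\<close> of the inverse of I - N, obtained by solving x = v + N x for the
  \<open>j\<close>-th unit vector v.\<close>

definition res :: "nat \<Rightarrow> nat \<Rightarrow> 'a fps" where
  "res i j = sol (\<lambda>i. if i = j then 1 else 0) i"

lemma res_eq: "res i j = (if i = j then 1 else 0) + (\<Sum>k. N i k * res k j)"
  unfolding res_def by (subst sol_eq) (simp add: act_def)

lemma res_unique:
  assumes "\<And>i. C i j = (if i = j then 1 else 0) + (\<Sum>k. N i k * C k j)"
  shows "C i j = res i j"
  unfolding res_def by (rule sol_unique[of "\<lambda>i. C i j"]) (simp add: act_def flip: assms)

text \<open>Associativity in disguise: the left side satisfies x = v + N x. The rows of
  \<open>res\<close> contain a diagonal 1 and need not be null families, so convergence on the left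
  rests on \<open>v\<close>.\<close>

lemma res_apply:
  assumes "null_family v"
  shows "(\<Sum>k. res i k * v k) = sol v i"
proof (rule sol_unique)
  fix i
  have null: "null_family (\<lambda>k. (if i = k then 1 else 0) * v k)"
             "null_family (\<lambda>k. (\<Sum>l. N i l * res l k) * v k)"
    by (intro null_family_mult_left assms)+
  have eq: "(\<Sum>l. N i l * res l k) * v k = (\<Sum>l. N i l * (res l k * v k))" for k
    using null_family_suminf_mult[OF null_act, of "v k" i "\<lambda>l. res l k"] by (simp add: ac_simps)
  have "res i k * v k = (if i = k then 1 else 0) * v k + (\<Sum>l. N i l * res l k) * v k" for k
    using res_eq[of i k] by (simp only: distrib_right)
  then have "(\<Sum>k. res i k * v k) =
      (\<Sum>k. (if i = k then 1 else 0) * v k) + (\<Sum>k. (\<Sum>l. N i l * res l k) * v k)"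
    by (simp only: null_family_suminf_add[OF null])
  also have "(\<Sum>k. (if i = k then 1 else 0) * v k) = (\<Sum>k. if k = i then v k else 0)"
    by (rule arg_cong[of _ _ suminf]) auto
  also have "(\<Sum>k. (\<Sum>l. N i l * res l k) * v k) = (\<Sum>l. \<Sum>k. N i l * (res l k * v k))"
    unfolding eq by (intro null_family_suminf_swap null_act null_family_mult_left assms)
  also have "\<dots> = act (\<lambda>l. \<Sum>k. res l k * v k) i"
    by (simp add: act_def null_family_suminf_mult null_family_mult_left assms)
  finally show "(\<Sum>k. res i k * v k) = v i + act (\<lambda>l. \<Sum>k. res l k * v k) i"
    by (simp only: suminf_delta)
qed

text \<open>Column \<open>j\<close> of \<open>res\<close> minus the identity solves x = v + N x with
  v the \<open>j\<close>-th column of N. This column is a null family, so \<open>res_apply\<close>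
  writes the same solution with N as the right factor.\<close>

lemma res_eq': "res i j = (if i = j then 1 else 0) + (\<Sum>k. res i k * N k j)"
proof -
  have "res i j - (if i = j then 1 else 0) = sol (\<lambda>i. N i j) i"
  proof (rule sol_unique)
    fix i
    have "act (\<lambda>k. res k j) i = act (\<lambda>k. res k j - (if k = j then 1 else 0)) i + N i j"
      using act_add[of "\<lambda>k. res k j - (if k = j then 1 else 0)" "\<lambda>k. if k = j then 1 else 0" i]
      by (simp add: act_unit)
    then show "res i j - (if i = j then 1 else 0) =
          N i j + act (\<lambda>k. res k j - (if k = j then 1 else 0)) i"
      using res_eq[of i j] by (simp add: act_def algebra_simps)
  qed
  then show ?thesis
    using res_apply[OF null_column] by (simp add: diff_eq_eq add.commute)
qed

text \<open>\<open>C\<close> is arbitrary because all decay comes from the rows of N; hence the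
  formula applies to any candidate inverse, not only to \<open>res\<close>.\<close>

lemma id_minus_mult_sums:
  "(\<lambda>k. ((if i = k then 1 else 0) - N i k) * C k j) sums (C i j - (\<Sum>k. N i k * C k j))"
proof -
  have null: "null_family (\<lambda>k. - 1 * (N i k * C k j))"
    by (intro null_family_mult_left null_act)
  have "(\<lambda>k. - 1 * (N i k * C k j) + (if k = i then C i j else 0)) sums
          ((\<Sum>k. - 1 * (N i k * C k j)) + C i j)"
    by (rule null_family_add_delta_sums'[OF null])
  also have "(\<Sum>k. - 1 * (N i k * C k j)) = - 1 * (\<Sum>k. N i k * C k j)"
    by (rule null_family_suminf_mult[OF null_act, symmetric])
  also have "(\<lambda>k. - 1 * (N i k * C k j) + (if k = i then C i j else 0)) =
      (\<lambda>k. ((if i = k then 1 else 0) - N i k) * C k j)"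
    by (auto simp: algebra_simps)
  finally show ?thesis by simp
qed

lemma mult_id_minus_sums:
  "(\<lambda>k. C i k * ((if k = j then 1 else 0) - N k j)) sums (C i j - (\<Sum>k. C i k * N k j))"
proof -
  have null': "null_family (\<lambda>k. C i k * N k j)"
    by (intro null_family_mult_left null_column)
  have null: "null_family (\<lambda>k. - 1 * (C i k * N k j))"
    by (intro null_family_mult_left null_column)
  have "(\<lambda>k. - 1 * (C i k * N k j) + (if k = j then C i j else 0)) sums
          ((\<Sum>k. - 1 * (C i k * N k j)) + C i j)"
    by (rule null_family_add_delta_sums'[OF null])
  also have "(\<Sum>k. - 1 * (C i k * N k j)) = - 1 * (\<Sum>k. C i k * N k j)"
    by (rule null_family_suminf_mult[OF null', symmetric])
  also have "(\<lambda>k. - 1 * (C i k * N k j) + (if k = j then C i j else 0)) =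
      (\<lambda>k. C i k * ((if k = j then 1 else 0) - N k j))"
    by (auto simp: algebra_simps)
  finally show ?thesis by simp
qed

lemma id_minus_mult_res:
  "(\<Sum>k. ((if i = k then 1 else 0) - N i k) * res k j) = (if i = j then 1 else 0)"
  using sums_unique[OF id_minus_mult_sums[of i res j]] res_eq[of i j] by (simp add: algebra_simps)

lemma res_mult_id_minus:
  "(\<Sum>k. res i k * ((if k = j then 1 else 0) - N k j)) = (if i = j then 1 else 0)"
  using sums_unique[OF mult_id_minus_sums[of res i j]] res_eq'[of i j] by (simp add: algebra_simps)

end

text \<open>The right inverse equation alone, rewritten as C = I + N C, has a unique solution column
  by column; conversely both products with \<open>res\<close> converge to the identity.\<close>

lemma inf_inverse_of_id_minus_iff:
  assumes "null_matrix N"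
  shows "inf_inverse_of (inf_minus inf_one N) C \<longleftrightarrow> C = null_matrix.res N"
proof -
  interpret null_matrix N by fact
  show ?thesis
  proof
    assume "inf_inverse_of (inf_minus inf_one N) C"
    then have *: "inf_mult (inf_minus inf_one N) C = inf_one"
      by (simp add: inf_inverse_of_def)
    have "C i j - (\<Sum>k. N i k * C k j) = (if i = j then 1 else 0)" for i j
      using fun_cong[OF fun_cong[OF *], of i j] sums_unique[OF id_minus_mult_sums[of i C j]]
      by (simp add: inf_mult_def inf_minus_def inf_one_def)
    then have "C i j = res i j" for i j
      by (intro res_unique iffD1[OF diff_eq_eq])
    then show "C = res" by (simp add: fun_eq_iff)
  next
    assume C: "C = res"
    show "inf_inverse_of (inf_minus inf_one N) C"
      unfolding inf_inverse_of_def inf_mult_def inf_minus_def inf_one_def C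
    proof (intro conjI allI ext)
      fix i j
      show "summable (\<lambda>k. ((if i = k then 1 else 0) - N i k) * res k j)"
        by (rule sums_summable[OF id_minus_mult_sums])
      show "summable (\<lambda>k. res i k * ((if k = j then 1 else 0) - N k j))"
        by (rule sums_summable[OF mult_id_minus_sums])
      show "(\<Sum>k. ((if i = k then 1 else 0) - N i k) * res k j) = (if i = j then 1 else 0)" by (rule id_minus_mult_res)
      show "(\<Sum>k. res i k * ((if k = j then 1 else 0) - N k j)) = (if i = j then 1 else 0)" by (rule res_mult_id_minus)
    qed
  qed
qed

section \<open>The transfer matrix\<close>

text \<open>As in the matrices, the index \<open>i\<close> stands for ranks of size \<open>Suc i\<close>. The set \<open>K\<close> consists of the
  indices of the allowed sizes, so that \<open>K = {..<r}\<close> and \<open>K = UNIV\<close> cover the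
  two parts of the theorem.\<close>

definition weight :: "nat set \<Rightarrow> nat \<Rightarrow> real fps" where
  "weight K i = (if i \<in> K then sqrt_term (Suc i) else 0)"

definition transfer :: "nat set \<Rightarrow> nat \<Rightarrow> nat \<Rightarrow> real fps" where
  "transfer K i j = weight K i * of_nat (psi_w (Suc i) (Suc j)) * weight K j"

lemma weight_nth_eq_0: "n \<le> i \<Longrightarrow> fps_nth (weight K i) n = 0"
  by (auto simp: weight_def sqrt_term_def simp del: power_Suc)

lemma weight_squared:
  "weight K i ^ 2 = fps_const (if i \<in> K then 1 / fact (Suc i) else 0) * fps_X ^ (2 * Suc i)"
  by (simp add: weight_def sqrt_term_squared x_var_def flip: power_mult
      del: fact_Suc power_Suc mult_Suc_right)

lemma null_weight: "null_family (weight K)"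
  by (simp add: null_family_def weight_nth_eq_0)

text \<open>From here on \<open>act\<close>, \<open>sol\<close> and \<open>res\<close> take the
  index set \<open>K\<close> as their first argument.\<close>

interpretation null_matrix "transfer K" for K
proof
  fix n i j :: nat
  assume "n \<le> i \<or> n \<le> j"
  then show "fps_nth (transfer K i j) n = 0"
    unfolding transfer_def fps_mult_nth
    by (auto intro!: sum.neutral simp: weight_nth_eq_0)
qed

text \<open>\<open>layer_count K k i n\<close> turns out to be the number of pairs consisting of a rank function of
  height \<open>Suc k\<close> on \<open>n\<close> points, whose bottom rank has size \<open>Suc i\<close>, and a set of covering pairs.\<close>

primrec layer_count :: "nat set \<Rightarrow> nat \<Rightarrow> nat \<Rightarrow> nat \<Rightarrow> nat" where
  "layer_count K 0 i n = (if i \<in> K \<and> n = Suc i then 1 else 0)"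
| "layer_count K (Suc k) i n =
     (if i \<in> K \<and> Suc i \<le> n
      then (n choose Suc i) * (\<Sum>j\<le>n. psi_w (Suc i) (Suc j) * layer_count K k j (n - Suc i))
      else 0)"

lemma layer_count_eq_0_size: "n \<le> i \<Longrightarrow> layer_count K k i n = 0"
  by (cases k) auto

text \<open>Every rank holds at least one point, so \<open>Suc k\<close> ranks need more than
  \<open>k\<close> points. This makes the sum over all heights finite in each coefficient.\<close>

lemma layer_count_eq_0_height: "n \<le> k \<Longrightarrow> layer_count K k i n = 0"
  by (induction k arbitrary: i n) auto

lemma layer_count_eq_0_index: "i \<notin> K \<Longrightarrow> layer_count K k i n = 0"
  by (cases k) auto

section \<open>Generating functions in x = t^2 and powers of the transfer matrix\<close>

lemma egf_x_nth:
  "fps_nth (egf_x e) m = (if even m then real (e (m div 2)) / fact (m div 2) else 0)"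
proof -
  have "fps_nth (egf_x e) m = (\<Sum>i=0..m. if m = 2 * i then real (e i) / fact i else 0)"
    unfolding egf_x_def fps_compose_nth egf_def x_var_def
    by (intro sum.cong) (simp_all flip: power_mult)
  also have "\<dots> = (\<Sum>i\<in>{0..m}. if i = m div 2 then (if even m then real (e i) / fact i else 0) else 0)"
    by (intro sum.cong) auto
  also have "\<dots> = (if even m then real (e (m div 2)) / fact (m div 2) else 0)"
    by simp
  finally show ?thesis .
qed

lemma null_egf_x:
  assumes "\<And>n i. n < i \<Longrightarrow> e i n = 0"
  shows "null_family (\<lambda>i. egf_x (e i))"
  unfolding null_family_def
proof (intro allI impI)
  fix i m :: nat
  assume "m < i"
  then show "fps_nth (egf_x (e i)) m = 0"
    using assms[of "m div 2" i] by (simp add: egf_x_nth)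
qed

lemma suminf_egf_x:
  assumes "\<And>n i. n < i \<Longrightarrow> e i n = 0"
  shows "(\<Sum>i. egf_x (e i)) = egf_x (\<lambda>n. \<Sum>i\<le>n. e i n)"
proof (rule fps_ext)
  fix m
  have "(\<Sum>i\<le>m. e i (m div 2)) = (\<Sum>i\<le>m div 2. e i (m div 2))"
    using assms by (intro sum.mono_neutral_right) auto
  then show "fps_nth (\<Sum>i. egf_x (e i)) m = fps_nth (egf_x (\<lambda>n. \<Sum>i\<le>n. e i n)) m"
    using null_family_suminf_nth[OF null_egf_x[of e] order_refl, of m] assms
    by (simp add: egf_x_nth flip: sum_divide_distrib of_nat_sum)
qed

text \<open>The outer \<open>weight K i\<close> meets its copy inside \<open>transfer K i j\<close>.
  Their product x^s / s! with s = i + 1 acts on exponential generating functions like the choice of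
  an s-element bottom rank, and the remaining factor \<open>weight K j\<close> is the one that the
  induction hypothesis needs.\<close>

lemma weight_act_pow: "weight K i * (act K ^^ k) (weight K) i = egf_x (layer_count K k i)"
proof (induction k arbitrary: i)
  case 0
  show ?case
  proof (rule fps_ext)
    fix m
    show "fps_nth (weight K i * (act K ^^ 0) (weight K) i) m = fps_nth (egf_x (layer_count K 0 i)) m"
      using weight_squared[of K i]
      by (auto simp: egf_x_nth power2_eq_square simp del: fact_Suc power_Suc mult_Suc_right)
  qed
next
  case (Suc k)
  have "weight K i * (act K ^^ Suc k) (weight K) i =
        (\<Sum>j. weight K i * (transfer K i j * (act K ^^ k) (weight K) j))"
    unfolding funpow.simps o_apply act_def[of K _ i]
    by (rule null_family_suminf_mult[OF null_act])
  also have "\<dots> = (\<Sum>j. weight K i ^ 2 * of_nat (psi_w (Suc i) (Suc j)) * egf_x (layer_count K k j))"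
    unfolding Suc[symmetric] transfer_def power2_eq_square by (simp only: ac_simps)
  also have "\<dots> = (\<Sum>j. weight K i ^ 2 * egf_x (\<lambda>n. psi_w (Suc i) (Suc j) * layer_count K k j n))"
  proof -
    have "of_nat c * egf_x e = egf_x (\<lambda>n. c * e n)" for c e
      by (rule fps_ext) (simp add: egf_x_nth)
    then show ?thesis by (simp add: mult.assoc)
  qed
  also have "\<dots> = weight K i ^ 2 *
      egf_x (\<lambda>n. \<Sum>j\<le>n. psi_w (Suc i) (Suc j) * layer_count K k j n)"
    by (subst null_family_suminf_mult[symmetric])
       (auto intro!: null_egf_x simp: suminf_egf_x layer_count_eq_0_size)
  also have "\<dots> = egf_x (layer_count K (Suc k) i)" (is "?l = ?r")
  proof (cases "i \<in> K")
    case True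
    show ?thesis
    proof (rule fps_ext)
      fix m
      \<comment> \<open>\<open>layer_count\<close> sums up to the full size \<open>n\<close>, the
        generating function of the remainder only up to \<open>n - Suc i\<close>; the additional
        terms vanish because a bottom rank cannot exceed the number of points.\<close>
      have *: "(\<Sum>j\<le>n - Suc i. psi_w (Suc i) (Suc j) * layer_count K k j (n - Suc i)) =
            (\<Sum>j\<le>n. psi_w (Suc i) (Suc j) * layer_count K k j (n - Suc i))" for n
        by (intro sum.mono_neutral_left) (auto simp: layer_count_eq_0_size)
      have "fps_nth ?l m = (if m < 2 * Suc i then 0 else
          1 / fact (Suc i) * fps_nth (egf_x (\<lambda>n. \<Sum>j\<le>n. psi_w (Suc i) (Suc j) * layer_count K k j n))
            (m - 2 * Suc i))"
        using True by (simp only: weight_squared mult.assoc fps_mult_left_const_nth fps_X_power_mult_nth) simp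
      also have "\<dots> = fps_nth ?r m"
      proof (cases "even m \<and> 2 * Suc i \<le> m")
        case m: True
        then obtain n where n: "m = 2 * n" "Suc i \<le> n"
          by auto
        have d: "(m - 2 * Suc i) div 2 = n - Suc i" "even (m - 2 * Suc i)"
          unfolding n(1) by (simp_all flip: diff_mult_distrib2 del: mult_Suc_right)
        \<comment> \<open>With s = \<open>Suc i\<close>, the factor 1 / (s! (n - s)!) equals (n
          choose s) / n!.\<close>
        show ?thesis
          unfolding egf_x_nth d(1) * using m d(2) True n
          by (simp add: binomial_fact del: of_nat_sum sum.atMost_Suc binomial_Suc_Suc fact_Suc)
      next
        case False
        then show ?thesis
          by (auto simp: egf_x_nth)
      qed
      finally show "fps_nth ?l m = fps_nth ?r m" .
    qed
  next
    case False
    then show ?thesis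
      by (intro fps_ext) (simp add: weight_def egf_x_nth layer_count_eq_0_index del: layer_count.simps)
  qed
  finally show ?case .
qed

lemma weight_sol: "weight K i * sol K (weight K) i = egf_x (\<lambda>n. \<Sum>k\<le>n. layer_count K k i n)"
  by (simp add: sol_def null_family_suminf_mult null_act_pow weight_act_pow
      suminf_egf_x layer_count_eq_0_height)

lemma weight_sol_sums:
  "(\<lambda>i. weight K i * sol K (weight K) i) sums egf_x (\<lambda>n. \<Sum>k\<le>n. \<Sum>i\<le>n. layer_count K k i n)"
proof -
  have "null_family (\<lambda>i. weight K i * sol K (weight K) i)"
    by (intro null_family_mult_right null_weight)
  then have "(\<lambda>i. weight K i * sol K (weight K) i) sums (\<Sum>i. weight K i * sol K (weight K) i)"
    by (rule summable_sums[OF null_family_summable])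
  also have "(\<Sum>i. weight K i * sol K (weight K) i) = egf_x (\<lambda>n. \<Sum>i\<le>n. \<Sum>k\<le>n. layer_count K k i n)"
    by (simp add: weight_sol suminf_egf_x layer_count_eq_0_size)
  also have "\<dots> = egf_x (\<lambda>n. \<Sum>k\<le>n. \<Sum>i\<le>n. layer_count K k i n)"
    by (intro arg_cong[of _ _ egf_x] ext sum.swap)
  finally show ?thesis .
qed

lemma weight_act_pow_sums:
  "(\<lambda>i. weight K i * (act K ^^ k) (weight K) i) sums egf_x (\<lambda>n. \<Sum>i\<le>n. layer_count K k i n)"
proof -
  have "null_family (\<lambda>i. weight K i * (act K ^^ k) (weight K) i)"
    by (intro null_family_mult_right null_weight)
  then have "(\<lambda>i. weight K i * (act K ^^ k) (weight K) i) sums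
      (\<Sum>i. weight K i * (act K ^^ k) (weight K) i)"
    by (rule summable_sums[OF null_family_summable])
  then show ?thesis
    by (simp add: weight_act_pow suminf_egf_x layer_count_eq_0_size)
qed

section \<open>The generating functions in matrix form\<close>

lemma suminf_eq_sum_lessThan:
  fixes f :: "nat \<Rightarrow> 'a::{comm_monoid_add, t2_space}"
  shows "(\<And>j. r \<le> j \<Longrightarrow> f j = 0) \<Longrightarrow> suminf f = (\<Sum>j<r. f j)"
  by (rule suminf_finite) auto

lemma transfer_eq_0: "i \<notin> K \<or> j \<notin> K \<Longrightarrow> transfer K i j = 0"
  by (auto simp: transfer_def weight_def)

lemma V_fin_eq: "V_fin r = vec r (weight {..<r})"
  by (auto simp: V_fin_def weight_def)

lemma DAD_fin_eq: "D_fin r * A_fin r * D_fin r = mat r r (\<lambda>(i, j). transfer {..<r} i j)"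
  unfolding D_fin_def by (subst mat_diag_mult_left[of _ r r], simp add: A_fin_def)
    (subst mat_diag_mult_right[of _ r r], auto simp: A_fin_def transfer_def weight_def)

text \<open>Library powers append the new factor on the right, whereas iterating \<open>act\<close>
  applies it on the left.\<close>

lemma pow_mat_Suc_left:
  assumes "M \<in> carrier_mat r r"
  shows "M ^\<^sub>m Suc k = M * M ^\<^sub>m k"
proof (induction k)
  case (Suc k)
  then show ?case
    using assoc_mult_mat[OF assms pow_carrier_mat[OF assms, of k] assms] by simp
qed (use assms in simp)

lemma pow_transfer_mult_weight:
  assumes "i < r"
  shows "vec_index ((mat r r (\<lambda>(i, j). transfer {..<r} i j) ^\<^sub>m k) *\<^sub>v vec r (weight {..<r})) i =
         (act {..<r} ^^ k) (weight {..<r}) i"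
  using assms
proof (induction k arbitrary: i)
  case (Suc k)
  let ?M = "mat r r (\<lambda>(i, j). transfer {..<r} i j)" and ?v = "vec r (weight {..<r})"
  have M: "?M \<in> carrier_mat r r" by simp
  have "vec_index ((?M ^\<^sub>m Suc k) *\<^sub>v ?v) i = vec_index (?M *\<^sub>v ((?M ^\<^sub>m k) *\<^sub>v ?v)) i"
    unfolding pow_mat_Suc_left[OF M] by (subst assoc_mult_mat_vec[OF M pow_carrier_mat[OF M]]) auto
  also have "\<dots> = (\<Sum>j<r. transfer {..<r} i j * vec_index ((?M ^\<^sub>m k) *\<^sub>v ?v) j)"
    using Suc.prems by (simp add: scalar_prod_def lessThan_atLeast0)
  also have "\<dots> = (\<Sum>j<r. transfer {..<r} i j * (act {..<r} ^^ k) (weight {..<r}) j)"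
    by (intro sum.cong) (simp_all add: Suc.IH del: index_mult_mat_vec)
  also have "\<dots> = act {..<r} ((act {..<r} ^^ k) (weight {..<r})) i"
    unfolding act_def[of _ _ i] by (rule suminf_eq_sum_lessThan[symmetric]) (simp add: transfer_eq_0)
  finally show ?case by simp
qed simp

text \<open>Bridge between the two index sets: \<open>weight {..<r}\<close> vanishes from index
  \<open>r\<close> on, so the series is already the finite scalar product.\<close>

lemma scalar_prod_sums:
  assumes "(\<lambda>i. weight {..<r} i * f i) sums s" "\<And>i. i < r \<Longrightarrow> vec_index u i = f i" "dim_vec u = r"
  shows "V_fin r \<bullet> u = s"
proof -
  have "V_fin r \<bullet> u = (\<Sum>i<r. weight {..<r} i * f i)"
    using assms(2,3) by (auto simp: V_fin_eq scalar_prod_def lessThan_atLeast0 intro!: sum.cong)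
  also have "\<dots> = s"
    unfolding sums_unique[OF assms(1)]
    by (rule suminf_eq_sum_lessThan[symmetric]) (simp add: weight_def)
  finally show ?thesis .
qed

lemma V_fin_pow:
  "V_fin r \<bullet> (((D_fin r * A_fin r * D_fin r) ^\<^sub>m k) *\<^sub>v V_fin r) =
   egf_x (\<lambda>n. \<Sum>i\<le>n. layer_count {..<r} k i n)"
  by (rule scalar_prod_sums[OF weight_act_pow_sums])
     (simp_all add: DAD_fin_eq V_fin_eq pow_transfer_mult_weight del: index_mult_mat_vec)

text \<open>The finite inverse is the upper left corner of the resolvent of the zero-padded infinite
  matrix. For a row or column index below \<open>r\<close>, the factor from I - N vanishes from
  \<open>r\<close> on, since the padding is zero and the diagonal 1 sits inside the corner.\<close>

lemma inverts_fin:
  "inverts_mat (1\<^sub>m r - D_fin r * A_fin r * D_fin r) (mat r r (\<lambda>(i, j). res {..<r} i j))"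
  "inverts_mat (mat r r (\<lambda>(i, j). res {..<r} i j)) (1\<^sub>m r - D_fin r * A_fin r * D_fin r)"
proof -
  let ?K = "{..<r}"
  have "(\<Sum>k<r. ((if i = k then 1 else 0) - transfer ?K i k) * res ?K k j) =
        (if i = j then 1 else 0)" if "i < r" for i j
  proof -
    have "(\<Sum>k<r. ((if i = k then 1 else 0) - transfer ?K i k) * res ?K k j) =
          (\<Sum>k. ((if i = k then 1 else 0) - transfer ?K i k) * res ?K k j)"
      using that by (intro suminf_eq_sum_lessThan[symmetric]) (simp add: transfer_eq_0)
    also have "\<dots> = (if i = j then 1 else 0)"
      by (rule id_minus_mult_res)
    finally show ?thesis .
  qed
  then show "inverts_mat (1\<^sub>m r - D_fin r * A_fin r * D_fin r) (mat r r (\<lambda>(i, j). res ?K i j))"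
    unfolding inverts_mat_def DAD_fin_eq
    by (intro eq_matI) (simp_all add: scalar_prod_def lessThan_atLeast0)
  have "(\<Sum>k<r. res ?K i k * ((if k = j then 1 else 0) - transfer ?K k j)) =
        (if i = j then 1 else 0)" if "j < r" for i j
  proof -
    have "(\<Sum>k<r. res ?K i k * ((if k = j then 1 else 0) - transfer ?K k j)) =
          (\<Sum>k. res ?K i k * ((if k = j then 1 else 0) - transfer ?K k j))"
      using that by (intro suminf_eq_sum_lessThan[symmetric]) (simp add: transfer_eq_0)
    also have "\<dots> = (if i = j then 1 else 0)"
      by (rule res_mult_id_minus)
    finally show ?thesis .
  qed
  then show "inverts_mat (mat r r (\<lambda>(i, j). res ?K i j)) (1\<^sub>m r - D_fin r * A_fin r * D_fin r)"
    unfolding inverts_mat_def DAD_fin_eq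
    by (intro eq_matI) (simp_all add: scalar_prod_def lessThan_atLeast0)
qed

lemma invertible_fin: "invertible_mat (1\<^sub>m r - D_fin r * A_fin r * D_fin r)"
  unfolding invertible_mat_def using inverts_fin by (auto simp: DAD_fin_eq)

lemma mat_inv_of_eq:
  assumes "M \<in> carrier_mat r r" "R \<in> carrier_mat r r" "inverts_mat M R" "inverts_mat R M"
  shows "mat_inv_of M = R"
  unfolding mat_inv_of_def
proof (rule the_equality)
  fix B
  assume B: "inverts_mat M B \<and> inverts_mat B M"
  \<comment> \<open>The definite description ranges over matrices of every format; comparing column
    counts in the two products with the identity fixes that of \<open>B\<close>.\<close>
  then have "dim_row B = r" "dim_col B = r"
    using assms(1) arg_cong[of "B * M" "1\<^sub>m (dim_row B)" dim_col, unfolded index_mult_mat index_one_mat]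
      arg_cong[of "M * B" "1\<^sub>m r" dim_col, unfolded index_mult_mat index_one_mat]
    by (auto simp: inverts_mat_def)
  then have "B \<in> carrier_mat r r" by auto
  then have "B = B * (M * R)" "R = B * M * R"
    using assms B by (auto simp: inverts_mat_def)
  then show "B = R"
    using assoc_mult_mat[OF \<open>B \<in> carrier_mat r r\<close> assms(1,2)] by simp
qed (use assms in simp)

lemma V_fin_inverse:
  "V_fin r \<bullet> (mat_inv_of (1\<^sub>m r - D_fin r * A_fin r * D_fin r) *\<^sub>v V_fin r) =
   egf_x (\<lambda>n. \<Sum>k\<le>n. \<Sum>i\<le>n. layer_count {..<r} k i n)"
proof (rule scalar_prod_sums[OF weight_sol_sums])
  have inv: "mat_inv_of (1\<^sub>m r - D_fin r * A_fin r * D_fin r) = mat r r (\<lambda>(i, j). res {..<r} i j)"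
    by (rule mat_inv_of_eq[where r = r, OF _ _ inverts_fin]) (simp_all add: DAD_fin_eq minus_carrier_mat)
  show "dim_vec (mat_inv_of (1\<^sub>m r - D_fin r * A_fin r * D_fin r) *\<^sub>v V_fin r) = r"
    by (simp add: inv)
  fix i
  assume "i < r"
  then have "vec_index (mat_inv_of (1\<^sub>m r - D_fin r * A_fin r * D_fin r) *\<^sub>v V_fin r) i =
        (\<Sum>j<r. res {..<r} i j * weight {..<r} j)"
    unfolding inv by (simp add: V_fin_eq scalar_prod_def lessThan_atLeast0)
  also have "\<dots> = (\<Sum>j. res {..<r} i j * weight {..<r} j)"
    by (rule suminf_eq_sum_lessThan[symmetric]) (simp add: weight_def)
  also have "\<dots> = sol {..<r} (weight {..<r}) i"
    by (rule res_apply[OF null_weight])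
  finally show "vec_index (mat_inv_of (1\<^sub>m r - D_fin r * A_fin r * D_fin r) *\<^sub>v V_fin r) i =
      sol {..<r} (weight {..<r}) i" .
qed

lemma V_inf_eq: "V_inf = weight UNIV"
  by (simp add: fun_eq_iff V_inf_def weight_def)

lemma DAD_inf_eq: "inf_mult (inf_mult D_inf A_inf) D_inf = transfer UNIV"
proof (intro ext)
  fix i j
  have DA: "inf_mult D_inf A_inf i k = weight UNIV i * A_inf i k" for k
  proof -
    have "inf_mult D_inf A_inf i k = (\<Sum>l. if l = i then weight UNIV l * A_inf l k else 0)"
      unfolding inf_mult_def by (rule arg_cong[of _ _ suminf]) (auto simp: D_inf_def weight_def)
    then show ?thesis by (simp only: suminf_delta)
  qed
  have "inf_mult (inf_mult D_inf A_inf) D_inf i j =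
        (\<Sum>k. if k = j then weight UNIV i * A_inf i k * weight UNIV k else 0)"
    unfolding inf_mult_def[of _ D_inf] DA
    by (rule arg_cong[of _ _ suminf]) (auto simp: D_inf_def weight_def)
  also have "\<dots> = transfer UNIV i j"
    by (simp only: suminf_delta transfer_def A_inf_def)
  finally show "inf_mult (inf_mult D_inf A_inf) D_inf i j = transfer UNIV i j" .
qed

lemma inf_inverse_DAD_iff:
  "inf_inverse_of (inf_minus inf_one (inf_mult (inf_mult D_inf A_inf) D_inf)) C \<longleftrightarrow> C = res UNIV"
  unfolding DAD_inf_eq by (rule inf_inverse_of_id_minus_iff) unfold_locales

lemma res_V_inf: "inf_mult_vec (res UNIV) V_inf = sol UNIV (weight UNIV)"
  by (simp add: fun_eq_iff inf_mult_vec_def V_inf_eq res_apply null_weight)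

section \<open>Weakly graded posets as sets of covering pairs\<close>

text \<open>Representatives of translation classes, normalised to start at 0. Rank sizes are shifted
  by one against \<open>K\<close>, just like the matrix indices.\<close>

definition rank_maps :: "nat set \<Rightarrow> nat \<Rightarrow> 'a set \<Rightarrow> ('a \<Rightarrow> int) set" where
  "rank_maps K k S = {\<rho> \<in> S \<rightarrow>\<^sub>E UNIV. \<rho> ` S = {0..<int k} \<and>
     (\<forall>c\<in>{0..<int k}. card {v \<in> S. \<rho> v = c} \<in> Suc ` K)}"

definition rank_steps :: "'a set \<Rightarrow> ('a \<Rightarrow> int) \<Rightarrow> ('a \<times> 'a) set" where
  "rank_steps S \<rho> = {(y, x) \<in> S \<times> S. \<rho> x = \<rho> y + 1}"

text \<open>The intersection removes the reflexive pairs outside \<open>S\<close> that the closure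
  adds.\<close>

definition generated_order :: "'a set \<Rightarrow> ('a \<times> 'a) set \<Rightarrow> ('a \<times> 'a) set" where
  "generated_order S E = E\<^sup>* \<inter> S \<times> S"

definition covering_pairs :: "'a set \<Rightarrow> ('a \<times> 'a) set \<Rightarrow> ('a \<times> 'a) set" where
  "covering_pairs S R = {(y, x) \<in> S \<times> S. covers R x y}"

lemma rtrancl_rank_steps:
  assumes "E \<subseteq> rank_steps S \<rho>" "(y, x) \<in> E\<^sup>*"
  shows "y = x \<or> (\<rho> y < \<rho> x \<and> y \<in> S \<and> x \<in> S)"
  using assms(2)
proof induction
  case (step z x)
  then have "\<rho> x = \<rho> z + 1" "z \<in> S" "x \<in> S"
    using assms(1) by (auto simp: rank_steps_def)
  with step.IH show ?case by auto
qed simp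

lemma partial_order_on_generated_order:
  assumes "E \<subseteq> rank_steps S \<rho>"
  shows "partial_order_on S (generated_order S E)"
proof -
  have "antisym (generated_order S E)"
  proof (rule antisymI)
    fix x y
    assume "(x, y) \<in> generated_order S E" "(y, x) \<in> generated_order S E"
    then show "x = y"
      using rtrancl_rank_steps[OF assms, of x y] rtrancl_rank_steps[OF assms, of y x]
      by (auto simp: generated_order_def)
  qed
  then show ?thesis
    by (auto simp: partial_order_on_def preorder_on_def refl_on_def trans_def generated_order_def)
qed

text \<open>A pair in \<open>E\<close> raises the rank by exactly one, which leaves no integer for
  an intermediate point; a longer chain does pass through such a point.\<close>

lemma covering_pairs_generated_order:
  assumes "E \<subseteq> rank_steps S \<rho>"
  shows "covering_pairs S (generated_order S E) = E"
proof (intro equalityI subsetI)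
  fix p
  assume "p \<in> covering_pairs S (generated_order S E)"
  then obtain y x where p: "p = (y, x)" "y \<in> S" "x \<in> S" and c: "covers (generated_order S E) x y"
    by (auto simp: covering_pairs_def)
  then have "(y, x) \<in> E\<^sup>*" "y \<noteq> x"
    by (auto simp: covers_def generated_order_def)
  \<comment> \<open>\<open>z\<close> is the second point of a chain from \<open>y\<close> to
    \<open>x\<close>; unless it equals \<open>x\<close>, it contradicts covering.\<close>
  then obtain z where z: "(y, z) \<in> E" "(z, x) \<in> E\<^sup>*"
    by (auto elim: converse_rtranclE)
  then have "z \<in> S" "y \<noteq> z"
    using assms by (auto simp: rank_steps_def)
  then have "z = x"
    using z c p by (auto simp: covers_def generated_order_def)
  then show "p \<in> E"
    using z p by simp
next
  fix p
  assume "p \<in> E"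
  then obtain y x where p: "p = (y, x)" "y \<in> S" "x \<in> S" "\<rho> x = \<rho> y + 1"
    using assms by (auto simp: rank_steps_def)
  have "False" if "(y, z) \<in> E\<^sup>*" "y \<noteq> z" "(z, x) \<in> E\<^sup>*" "z \<noteq> x" for z
    using rtrancl_rank_steps[OF assms that(1)] rtrancl_rank_steps[OF assms that(3)] that p by auto
  with p \<open>p \<in> E\<close> show "p \<in> covering_pairs S (generated_order S E)"
    by (auto simp: covering_pairs_def covers_def generated_order_def)
qed

text \<open>Induction on the size of the closed interval from \<open>y\<close> to \<open>x\<close>:
  a point strictly between them splits the problem into two smaller intervals.\<close>

lemma generated_order_covering_pairs:
  assumes "finite S" "partial_order_on S R"
  shows "generated_order S (covering_pairs S R) = R"
proof -
  from assms(2) have R: "R \<subseteq> S \<times> S" "refl_on S R" "trans R" "antisym R"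
    by (auto simp: partial_order_on_def preorder_on_def)
  have sub: "covering_pairs S R \<subseteq> R"
    by (auto simp: covering_pairs_def covers_def)
  have "(y, x) \<in> (covering_pairs S R)\<^sup>*" if "(y, x) \<in> R" for y x
    using that
  proof (induction "card {z. (y, z) \<in> R \<and> (z, x) \<in> R}" arbitrary: x y rule: less_induct)
    case less
    have fin: "finite {z. (y, z) \<in> R \<and> (z, x) \<in> R}"
      by (rule finite_subset[OF _ assms(1)]) (use R(1) in auto)
    consider "y = x" | "covers R x y" | z where "(y, z) \<in> R" "y \<noteq> z" "(z, x) \<in> R" "z \<noteq> x"
      using less.prems by (auto simp: covers_def)
    then show ?case
    proof cases
      case 2
      then have "(y, x) \<in> covering_pairs S R"
        using less.prems R(1) by (auto simp: covering_pairs_def)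
      then show ?thesis ..
    next
      case (3 z)
      have refl: "(y, y) \<in> R" "(x, x) \<in> R"
        using 3 R(1,2) by (auto simp: refl_on_def)
      \<comment> \<open>By antisymmetry the lower interval loses \<open>x\<close> and the upper one
        loses \<open>y\<close>, so both inclusions below are strict.\<close>
      have nin: "(x, z) \<notin> R" "(z, y) \<notin> R"
        using 3 R(4) by (auto dest: antisymD)
      have "{w. (y, w) \<in> R \<and> (w, z) \<in> R} \<subset> {w. (y, w) \<in> R \<and> (w, x) \<in> R}"
        using 3 refl nin less.prems R(3) by (auto dest: transD)
      moreover have "{w. (z, w) \<in> R \<and> (w, x) \<in> R} \<subset> {w. (y, w) \<in> R \<and> (w, x) \<in> R}"
        using 3 refl nin less.prems R(3) by (auto dest: transD)
      ultimately have "(y, z) \<in> (covering_pairs S R)\<^sup>*" "(z, x) \<in> (covering_pairs S R)\<^sup>*"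
        using 3 by (auto intro!: less.hyps psubset_card_mono[OF fin])
      then show ?thesis by (rule rtrancl_trans)
    qed simp
  qed
  moreover have "(y, x) \<in> R" if "(y, x) \<in> (covering_pairs S R)\<^sup>*" "y \<in> S" for y x
    using that by induction (use sub R(2,3) in \<open>auto simp: refl_on_def dest: transD\<close>)
  ultimately show ?thesis
    using R(1) by (auto simp: generated_order_def)
qed

section \<open>Translation classes of rank functions\<close>

lemma equiv_translation_rel: "equiv (S \<rightarrow>\<^sub>E UNIV) (translation_rel S)"
proof (rule equivI)
  show "sym (translation_rel S)"
  proof (rule symI)
    fix \<rho> \<sigma>
    assume "(\<rho>, \<sigma>) \<in> translation_rel S"
    then obtain c where "\<rho> \<in> S \<rightarrow>\<^sub>E UNIV" "\<sigma> \<in> S \<rightarrow>\<^sub>E UNIV" "\<forall>v\<in>S. \<sigma> v = \<rho> v + c"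
      by (auto simp: translation_rel_def)
    then have "\<forall>v\<in>S. \<rho> v = \<sigma> v + - c" by simp
    with \<open>\<rho> \<in> _\<close> \<open>\<sigma> \<in> _\<close> show "(\<sigma>, \<rho>) \<in> translation_rel S"
      unfolding translation_rel_def by blast
  qed
  show "trans (translation_rel S)"
  proof (rule transI)
    fix \<rho> \<sigma> \<tau>
    assume "(\<rho>, \<sigma>) \<in> translation_rel S"
    then obtain c where "\<rho> \<in> S \<rightarrow>\<^sub>E UNIV" and c: "\<forall>v\<in>S. \<sigma> v = \<rho> v + c"
      by (auto simp: translation_rel_def)
    assume "(\<sigma>, \<tau>) \<in> translation_rel S"
    then obtain d where "\<tau> \<in> S \<rightarrow>\<^sub>E UNIV" and d: "\<forall>v\<in>S. \<tau> v = \<sigma> v + d"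
      by (auto simp: translation_rel_def)
    from c d have "\<forall>v\<in>S. \<tau> v = \<rho> v + (c + d)" by simp
    with \<open>\<rho> \<in> _\<close> \<open>\<tau> \<in> _\<close> show "(\<rho>, \<tau>) \<in> translation_rel S"
      unfolding translation_rel_def by blast
  qed
  have "\<exists>c::int. \<forall>v\<in>S. \<rho> v = \<rho> v + c" for \<rho> :: "_ \<Rightarrow> int"
    by (rule exI[of _ 0]) simp
  then show "refl_on (S \<rightarrow>\<^sub>E UNIV) (translation_rel S)"
    by (auto simp: refl_on_def translation_rel_def)
  show "translation_rel S \<subseteq> (S \<rightarrow>\<^sub>E UNIV) \<times> (S \<rightarrow>\<^sub>E UNIV)"
    by (auto simp: translation_rel_def)
qed

text \<open>The integer \<open>c\<close> is unrestricted, so values that are not taken contribute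
  the size 0.\<close>

definition allowed_ranks :: "nat set \<Rightarrow> 'a set \<Rightarrow> 'a wg_poset \<Rightarrow> bool" where
  "allowed_ranks K S P \<longleftrightarrow> (\<forall>\<rho>\<in>snd P. \<forall>c. card {v \<in> S. \<rho> v = c} \<in> insert 0 (Suc ` K))"

lemma translate_rank_map_unique:
  assumes "\<rho> \<in> rank_maps K k S" "\<rho>' \<in> rank_maps K' k' S" "k \<ge> 1" "k' \<ge> 1"
    and "(\<rho>, \<rho>') \<in> translation_rel S"
  shows "\<rho> = \<rho>'"
proof -
  from assms(5) obtain c where c: "\<forall>v\<in>S. \<rho>' v = \<rho> v + c"
    by (auto simp: translation_rel_def)
  have im: "\<rho> ` S = {0..<int k}" "\<rho>' ` S = {0..<int k'}"
    using assms by (auto simp: rank_maps_def)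
  then have "0 \<in> \<rho> ` S" "0 \<in> \<rho>' ` S"
    using assms(3,4) by auto
  \<comment> \<open>At a zero of \<open>\<rho>\<close> the nonnegative value of
    \<open>\<rho>'\<close> is \<open>c\<close>, and at a zero of \<open>\<rho>'\<close> the
    nonnegative value of \<open>\<rho>\<close> is \<open>- c\<close>.\<close>
  then obtain v v' where v: "v \<in> S" "\<rho> v = 0" "v' \<in> S" "\<rho>' v' = 0"
    by (metis imageE)
  then have "\<rho>' v \<ge> 0" "\<rho> v' \<ge> 0"
    using im by (metis atLeastLessThan_iff imageI)+
  then have "c = 0"
    using c v by force
  with c show ?thesis
    using assms(1,2) by (intro PiE_ext[of \<rho> S "\<lambda>_. UNIV" \<rho>']) (auto simp: rank_maps_def)
qed

lemma rank_functions_translate: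
  assumes "\<sigma> \<in> rank_functions S R" "(\<sigma>, \<rho>) \<in> translation_rel S"
  shows "\<rho> \<in> rank_functions S R"
  using assms by (auto simp: rank_functions_def translation_rel_def)

lemma bij_betw_wg_posets:
  fixes S :: "'a set"
  assumes "finite S" "\<forall>k\<in>H. k \<ge> 1"
  shows "bij_betw (\<lambda>(\<rho>, E). (generated_order S E, translation_rel S `` {\<rho>}))
     (SIGMA \<rho>:(\<Union>k\<in>H. rank_maps K k S). Pow (rank_steps S \<rho>))
     {P \<in> wg_posets S. (\<exists>k\<in>H. has_height S k P) \<and> allowed_ranks K S P}"
    (is "bij_betw ?g ?A ?B")
  unfolding bij_betw_def
proof (intro conjI equalityI)
  note eqv = equiv_translation_rel[of S]
  show "inj_on ?g ?A"
  proof (rule inj_onI)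
    fix p p'
    assume "p \<in> ?A" "p' \<in> ?A" and eq: "?g p = ?g p'"
    then obtain \<rho> E k \<rho>' E' k' where p: "p = (\<rho>, E)" "p' = (\<rho>', E')" "k \<in> H" "k' \<in> H"
        "\<rho> \<in> rank_maps K k S" "\<rho>' \<in> rank_maps K k' S" "E \<subseteq> rank_steps S \<rho>" "E' \<subseteq> rank_steps S \<rho>'"
      by auto
    have "\<rho>' \<in> S \<rightarrow>\<^sub>E UNIV"
      using p by (simp add: rank_maps_def)
    then have "(\<rho>, \<rho>') \<in> translation_rel S"
      using eq p eq_equiv_class[OF _ eqv, of \<rho> \<rho>'] by simp
    then have "\<rho> = \<rho>'"
      using p assms(2) by (intro translate_rank_map_unique[of \<rho> K k S \<rho>' K k']) auto
    moreover have "generated_order S E = generated_order S E'"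
      using eq p by simp
    then have "E = E'"
      by (metis p(7,8) covering_pairs_generated_order)
    ultimately show "p = p'"
      using p by simp
  qed
  show "?g ` ?A \<subseteq> ?B"
  proof (intro image_subsetI)
    fix p
    assume "p \<in> ?A"
    then obtain \<rho> E k where p: "p = (\<rho>, E)" "k \<in> H" "\<rho> \<in> rank_maps K k S" "E \<subseteq> rank_steps S \<rho>"
      by auto
    have ext: "\<rho> \<in> S \<rightarrow>\<^sub>E UNIV" and im: "\<rho> ` S = {0..<int k}"
      using p by (simp_all add: rank_maps_def)
    have "\<rho> x - \<rho> y = 1" if "x \<in> S" "y \<in> S" "covers (generated_order S E) x y" for x y
    proof -
      have "(y, x) \<in> covering_pairs S (generated_order S E)"
        using that by (simp add: covering_pairs_def)
      then show ?thesis
        using p(4) unfolding covering_pairs_generated_order[OF p(4)] by (auto simp: rank_steps_def)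
    qed
    then have "\<rho> \<in> rank_functions S (generated_order S E)"
      using ext by (simp add: rank_functions_def)
    then have "?g p \<in> wg_posets S"
      using p partial_order_on_generated_order[OF p(4)] by (simp add: wg_posets_def quotientI)
    moreover have "has_height S k (?g p)"
      using p im equiv_class_self[OF eqv ext] by (auto simp: has_height_def)
    moreover have "allowed_ranks K S (?g p)"
      unfolding allowed_ranks_def
    proof (intro ballI allI)
      fix \<sigma> c
      assume "\<sigma> \<in> snd (?g p)"
      then obtain d where "\<forall>v\<in>S. \<sigma> v = \<rho> v + d"
        using p by (auto simp: translation_rel_def)
      then have *: "{v \<in> S. \<sigma> v = c} = {v \<in> S. \<rho> v = c - d}"
        by auto
      show "card {v \<in> S. \<sigma> v = c} \<in> insert 0 (Suc ` K)"
      proof (cases "c - d \<in> {0..<int k}")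
        case True
        then show ?thesis
          using p unfolding * by (simp add: rank_maps_def)
      next
        case False
        then have "c - d \<notin> \<rho> ` S"
          unfolding im .
        then have empty: "{v \<in> S. \<rho> v = c - d} = {}"
          by (metis (mono_tags, lifting) Collect_empty_eq imageI)
        show ?thesis
          unfolding * empty by simp
      qed
    qed
    ultimately show "?g p \<in> ?B"
      using p(2) by blast
  qed
  show "?B \<subseteq> ?g ` ?A"
  proof
    fix P
    assume P: "P \<in> ?B"
    then obtain R C k \<sigma> \<rho> where P': "P = (R, C)" "partial_order_on S R" "k \<in> H"
        "\<sigma> \<in> rank_functions S R" "C = translation_rel S `` {\<sigma>}" "\<rho> \<in> C" "\<rho> ` S = {0..<int k}"
      unfolding wg_posets_def has_height_def by (auto elim!: quotientE)
    then have \<sigma>\<rho>: "(\<sigma>, \<rho>) \<in> translation_rel S" by simp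
    \<comment> \<open>The representative \<open>\<sigma>\<close> supplied by the quotient is
      exchanged for the one that witnesses the height.\<close>
    have rf: "\<rho> \<in> rank_functions S R"
      by (rule rank_functions_translate[OF P'(4) \<sigma>\<rho>])
    have C: "C = translation_rel S `` {\<rho>}"
      unfolding P'(5) by (rule equiv_class_eq[OF eqv \<sigma>\<rho>])
    have "card {v \<in> S. \<rho> v = c} \<in> Suc ` K" if "c \<in> {0..<int k}" for c
    proof -
      have "card {v \<in> S. \<rho> v = c} \<in> insert 0 (Suc ` K)"
        using P P' by (auto simp: allowed_ranks_def)
      moreover have "c \<in> \<rho> ` S"
        using that unfolding P'(7) .
      then have "{v \<in> S. \<rho> v = c} \<noteq> {}"
        by auto
      ultimately show ?thesis
        using assms(1) by auto
    qed
    then have "\<rho> \<in> rank_maps K k S"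
      using P'(7) rf by (simp add: rank_maps_def rank_functions_def)
    moreover have "covering_pairs S R \<subseteq> rank_steps S \<rho>"
      using rf by (force simp: covering_pairs_def rank_steps_def rank_functions_def)
    ultimately have "(\<rho>, covering_pairs S R) \<in> ?A"
      using P'(3) by auto
    moreover have "P = ?g (\<rho>, covering_pairs S R)"
      using P' C generated_order_covering_pairs[OF assms(1) P'(2)] by simp
    ultimately show "P \<in> ?g ` ?A" by blast
  qed
qed

section \<open>Counting\<close>

text \<open>The power of 2 counts the subsets of \<open>rank_steps S \<rho>\<close>, each of which
  is a possible set of covering pairs.\<close>

definition structures :: "nat set \<Rightarrow> nat \<Rightarrow> 'a set \<Rightarrow> nat" where
  "structures K k S = (\<Sum>\<rho>\<in>rank_maps K k S. 2 ^ card (rank_steps S \<rho>))"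

definition bottom_size :: "'a set \<Rightarrow> ('a \<Rightarrow> int) \<Rightarrow> nat" where
  "bottom_size S \<rho> = card {v \<in> S. \<rho> v = 0}"

lemma finite_rank_maps: "finite S \<Longrightarrow> finite (rank_maps K k S)"
  by (rule finite_subset[of _ "S \<rightarrow>\<^sub>E {0..<int k}"]) (auto simp: rank_maps_def PiE_iff extensional_def intro!: finite_PiE)

lemma rank_maps_disjoint:
  assumes "i \<noteq> j"
  shows "rank_maps K i S \<inter> rank_maps K j S = {}"
proof -
  have "card {0..<int i} \<noteq> card {0..<int j}"
    using assms by simp
  then show ?thesis
    by (auto simp only: rank_maps_def)
qed

lemma finite_rank_steps: "finite S \<Longrightarrow> finite (rank_steps S \<rho>)"
  by (rule finite_subset[of _ "S \<times> S"]) (auto simp: rank_steps_def)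

lemma bottom_size_range:
  assumes "\<rho> \<in> rank_maps K (Suc k) S" "finite S"
  shows "bottom_size S \<rho> \<in> Suc ` (K \<inter> {..<card S})"
proof -
  have "card {v \<in> S. \<rho> v = 0} \<in> Suc ` K"
    using assms(1) by (simp add: rank_maps_def)
  moreover have "card {v \<in> S. \<rho> v = 0} \<le> card S"
    using assms(2) by (intro card_mono) auto
  ultimately show ?thesis
    by (auto simp: bottom_size_def)
qed

text \<open>The cutoff \<open>n\<close> may exceed \<open>card S\<close>: after a bottom rank has
  been removed, the recursion still sums up to the size of the original set.\<close>

lemma sum_rank_maps_bottom:
  assumes "finite S" "card S \<le> n"
  shows "(\<Sum>\<rho>\<in>rank_maps K (Suc k) S. f \<rho>) =
         (\<Sum>i\<le>n. \<Sum>\<rho> | \<rho> \<in> rank_maps K (Suc k) S \<and> bottom_size S \<rho> = Suc i. f \<rho>)"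
proof -
  have "bottom_size S ` rank_maps K (Suc k) S \<subseteq> Suc ` {..n}"
    using assms by (intro image_subsetI) (auto dest!: bottom_size_range)
  from sum.group[OF finite_rank_maps[OF assms(1)] _ this, of f]
  show ?thesis
    by (simp add: sum.reindex)
qed

text \<open>A rank function is determined by its bottom rank \<open>A\<close> and the rank function \<open>\<tau>\<close> that it induces
  on the remaining points.\<close>

definition add_bottom :: "'a set \<Rightarrow> 'a set \<Rightarrow> ('a \<Rightarrow> int) \<Rightarrow> 'a \<Rightarrow> int" where
  "add_bottom S A \<tau> = restrict (\<lambda>v. if v \<in> A then 0 else \<tau> v + 1) S"

lemma add_bottom_nth: "v \<in> S \<Longrightarrow> add_bottom S A \<tau> v = (if v \<in> A then 0 else \<tau> v + 1)"
  by (simp add: add_bottom_def)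

lemma rank_map_nonneg: "\<tau> \<in> rank_maps K k S \<Longrightarrow> v \<in> S \<Longrightarrow> 0 \<le> \<tau> v"
  by (auto simp: rank_maps_def)

lemma fibre_add_bottom_0:
  assumes "\<tau> \<in> rank_maps K k (S - A)" "A \<subseteq> S"
  shows "{v \<in> S. add_bottom S A \<tau> v = 0} = A"
proof -
  have "\<tau> v + 1 \<noteq> 0" if "v \<in> S - A" for v
    using rank_map_nonneg[OF assms(1) that] by simp
  then show ?thesis
    using assms(2) by (auto simp: add_bottom_nth split: if_splits)
qed

lemma fibre_add_bottom:
  assumes "c \<noteq> 0"
  shows "{v \<in> S. add_bottom S A \<tau> v = c} = {v \<in> S - A. \<tau> v = c - 1}"
  using assms by (auto simp: add_bottom_nth)

lemma atLeastLessThan_int_Suc: "{0..<int (Suc k)} = insert 0 ((\<lambda>c. c + 1) ` {0..<int k})"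
proof -
  have "c \<in> (\<lambda>c. c + 1) ` {0..<int k}" if "0 < c" "c < int (Suc k)" for c
    using that by (intro image_eqI[of _ _ "c - 1"]) auto
  then show ?thesis by auto
qed

lemma add_bottom_rank_maps:
  assumes "A \<subseteq> S" "card A = Suc i" "i \<in> K" "\<tau> \<in> rank_maps K k (S - A)"
  shows "add_bottom S A \<tau> \<in> rank_maps K (Suc k) S"
proof -
  have "A \<noteq> {}" using assms(2) by auto
  have "add_bottom S A \<tau> ` S = add_bottom S A \<tau> ` (A \<union> (S - A))"
    using assms(1) by (simp add: Un_absorb1)
  also have "\<dots> = insert 0 ((\<lambda>c. c + 1) ` \<tau> ` (S - A))"
    using assms(1) \<open>A \<noteq> {}\<close> unfolding image_Un image_image by (force simp: add_bottom_nth)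
  also have "\<dots> = {0..<int (Suc k)}"
    using assms(4) by (simp only: atLeastLessThan_int_Suc) (simp add: rank_maps_def)
  finally have "add_bottom S A \<tau> ` S = {0..<int (Suc k)}" .
  moreover have "card {v \<in> S. add_bottom S A \<tau> v = c} \<in> Suc ` K" if "c \<in> {0..<int (Suc k)}" for c
  proof (cases "c = 0")
    case True
    then show ?thesis
      using fibre_add_bottom_0[OF assms(4,1)] assms(2,3) by simp
  next
    case False
    then show ?thesis
      using assms(4) that by (simp add: fibre_add_bottom rank_maps_def)
  qed
  ultimately show ?thesis
    by (simp add: rank_maps_def add_bottom_def)
qed

text \<open>The old ranks are nonnegative and move up by one, so only the old bottom rank lies one
  step above \<open>A\<close>, and no step ends in \<open>A\<close>.\<close>

lemma rank_steps_add_bottom: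
  fixes S :: "'a set"
  assumes "\<tau> \<in> rank_maps K k (S - A)" "A \<subseteq> S"
  shows "rank_steps S (add_bottom S A \<tau>) = A \<times> {v \<in> S - A. \<tau> v = 0} \<union> rank_steps (S - A) \<tau>"
proof (rule Set.set_eqI)
  fix p :: "'a \<times> 'a"
  obtain y x where p: "p = (y, x)" by fastforce
  show "p \<in> rank_steps S (add_bottom S A \<tau>) \<longleftrightarrow>
      p \<in> A \<times> {v \<in> S - A. \<tau> v = 0} \<union> rank_steps (S - A) \<tau>"
    using rank_map_nonneg[OF assms(1), of y] assms(2) unfolding p
    by (cases "x \<in> A"; cases "y \<in> A") (auto simp: rank_steps_def add_bottom_nth)
qed

text \<open>As an exponent of 2, the product of the two sizes becomes the factor
  \<open>psi_w\<close> of the transfer matrix.\<close>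

lemma card_rank_steps_add_bottom:
  assumes "\<tau> \<in> rank_maps K k (S - A)" "A \<subseteq> S" "finite S"
  shows "card (rank_steps S (add_bottom S A \<tau>)) =
         card A * bottom_size (S - A) \<tau> + card (rank_steps (S - A) \<tau>)"
proof -
  have "finite A" by (rule finite_subset[OF assms(2,3)])
  then show ?thesis
    unfolding rank_steps_add_bottom[OF assms(1,2)] using assms(3) finite_rank_steps[of "S - A" \<tau>]
    by (subst card_Un_disjoint) (auto simp: bottom_size_def rank_steps_def card_cartesian_product)
qed

lemma bij_betw_add_bottom:
  assumes "i \<in> K" "finite S"
  shows "bij_betw (\<lambda>(A, \<tau>). add_bottom S A \<tau>)
     (SIGMA A:{A. A \<subseteq> S \<and> card A = Suc i}. rank_maps K (Suc k) (S - A))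
     {\<rho> \<in> rank_maps K (Suc (Suc k)) S. bottom_size S \<rho> = Suc i}"
\<comment> \<open>The inverse map splits off the fibre over 0 and lowers all other ranks by
  one.\<close>
proof (rule bij_betw_byWitness[where f' = "\<lambda>\<rho>. ({v \<in> S. \<rho> v = 0}, restrict (\<lambda>v. \<rho> v - 1) {v \<in> S. \<rho> v \<noteq> 0})"])
  let ?A = "SIGMA A:{A. A \<subseteq> S \<and> card A = Suc i}. rank_maps K (Suc k) (S - A)"
  let ?B = "{\<rho> \<in> rank_maps K (Suc (Suc k)) S. bottom_size S \<rho> = Suc i}"
  let ?f = "\<lambda>(A, \<tau>). add_bottom S A \<tau>"
  let ?g = "\<lambda>\<rho>. ({v \<in> S. \<rho> v = 0}, restrict (\<lambda>v. \<rho> v - 1) {v \<in> S. \<rho> v \<noteq> 0})"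
  show "\<forall>a\<in>?A. ?g (?f a) = a"
  proof
    fix a assume "a \<in> ?A"
    then obtain A \<tau> where a: "a = (A, \<tau>)" "A \<subseteq> S" "\<tau> \<in> rank_maps K (Suc k) (S - A)"
      by auto
    have fib: "{v \<in> S. add_bottom S A \<tau> v = 0} = A"
      using a by (intro fibre_add_bottom_0)
    then have "{v \<in> S. add_bottom S A \<tau> v \<noteq> 0} = S - A"
      by auto
    moreover have "restrict (\<lambda>v. add_bottom S A \<tau> v - 1) (S - A) = \<tau>"
    proof (rule extensionalityI[of _ "S - A"])
      show "\<tau> \<in> extensional (S - A)"
        using a(3) by (simp add: rank_maps_def PiE_def)
    qed (auto simp: add_bottom_nth)
    ultimately show "?g (?f a) = a"
      using a(1) fib by simp
  qed
  show "\<forall>\<rho>\<in>?B. ?f (?g \<rho>) = \<rho>"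
  proof
    fix \<rho>
    assume "\<rho> \<in> ?B"
    then have "\<rho> \<in> extensional S"
      by (simp add: rank_maps_def PiE_def)
    then show "?f (?g \<rho>) = \<rho>"
      unfolding prod.case by (intro extensionalityI[of _ S]) (auto simp: add_bottom_def)
  qed
  show "?f ` ?A \<subseteq> ?B"
  proof (intro image_subsetI)
    fix a
    assume "a \<in> ?A"
    then obtain A \<tau> where a: "a = (A, \<tau>)" "A \<subseteq> S" "card A = Suc i" "\<tau> \<in> rank_maps K (Suc k) (S - A)"
      by auto
    then show "?f a \<in> ?B"
      using add_bottom_rank_maps[OF a(2,3) assms(1) a(4)] fibre_add_bottom_0[OF a(4,2)]
      by (simp add: bottom_size_def)
  qed
  show "?g ` ?B \<subseteq> ?A"
  proof (intro image_subsetI)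
    fix \<rho>
    assume \<rho>: "\<rho> \<in> ?B"
    let ?T = "{v \<in> S. \<rho> v \<noteq> 0}" and ?\<tau> = "restrict (\<lambda>v. \<rho> v - 1) {v \<in> S. \<rho> v \<noteq> 0}"
    have T: "S - {v \<in> S. \<rho> v = 0} = ?T" by auto
    have im: "\<rho> ` S = {0..<int (Suc (Suc k))}"
      using \<rho> by (simp add: rank_maps_def)
    have "?\<tau> ` ?T = (\<lambda>c. c - 1) ` (\<rho> ` S - {0})"
      by (auto simp: image_iff)
    also have "\<rho> ` S - {0} = (\<lambda>c. c + 1) ` {0..<int (Suc k)}"
      unfolding im atLeastLessThan_int_Suc[of "Suc k"] by auto
    also have "(\<lambda>c. c - 1) ` (\<lambda>c. c + 1) ` {0..<int (Suc k)} = {0..<int (Suc k)}"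
      by (simp only: image_image add_diff_cancel_right' image_ident)
    finally have "?\<tau> ` ?T = {0..<int (Suc k)}" .
    moreover have "card {v \<in> ?T. ?\<tau> v = c} \<in> Suc ` K" if "c \<in> {0..<int (Suc k)}" for c
    proof -
      have "{v \<in> ?T. ?\<tau> v = c} = {v \<in> S. \<rho> v = c + 1}"
        using that by auto
      moreover have "c + 1 \<in> {0..<int (Suc (Suc k))}"
        using that by auto
      ultimately show ?thesis
        using \<rho> by (simp only: rank_maps_def mem_Collect_eq)
    qed
    ultimately have "?\<tau> \<in> rank_maps K (Suc k) ?T"
      by (simp add: rank_maps_def)
    then show "?g \<rho> \<in> ?A"
      using \<rho> unfolding mem_Sigma_iff T by (auto simp: bottom_size_def)
  qed
qed

lemma rank_maps_Suc_0:
  assumes "finite S"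
  shows "rank_maps K (Suc 0) S = (if card S \<in> Suc ` K then {restrict (\<lambda>_. 0) S} else {})"
proof -
  have "\<rho> \<in> rank_maps K (Suc 0) S \<longleftrightarrow> \<rho> = restrict (\<lambda>_. 0) S \<and> card S \<in> Suc ` K" for \<rho>
  proof
    assume \<rho>: "\<rho> \<in> rank_maps K (Suc 0) S"
    then have ext: "\<rho> \<in> extensional S" and im: "\<rho> ` S = {0..<1}"
      by (simp_all add: rank_maps_def PiE_def)
    have zero: "\<rho> v = 0" if "v \<in> S" for v
      using imageI[OF that, of \<rho>] unfolding im by simp
    then have "\<rho> = restrict (\<lambda>_. 0) S"
      by (intro extensionalityI[OF ext, of "restrict (\<lambda>_. 0) S"]) simp_all
    moreover have "{v \<in> S. \<rho> v = 0} = S"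
      using zero by auto
    moreover have "card {v \<in> S. \<rho> v = 0} \<in> Suc ` K"
      using \<rho> by (simp add: rank_maps_def)
    ultimately show "\<rho> = restrict (\<lambda>_. 0) S \<and> card S \<in> Suc ` K"
      by (simp only:)
  next
    assume \<rho>: "\<rho> = restrict (\<lambda>_. 0) S \<and> card S \<in> Suc ` K"
    then have "S \<noteq> {}" by auto
    then have "\<rho> ` S = {0}"
      using \<rho> by auto
    moreover have "{v \<in> S. \<rho> v = 0} = S"
      using \<rho> by auto
    moreover have "{0..<int (Suc 0)} = {0}"
      by auto
    ultimately show "\<rho> \<in> rank_maps K (Suc 0) S"
      using \<rho> by (simp only: rank_maps_def) simp
  qed
  then show ?thesis by auto
qed

text \<open>The recursion of \<open>layer_count\<close> read on rank functions: the choice of the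
  bottom rank \<open>A\<close> gives the binomial coefficient, the steps leaving \<open>A\<close>
  give \<open>psi_w\<close>, and the count for \<open>S - A\<close> depends on its size
  only.\<close>

lemma structures_bottom:
  fixes S :: "'a set"
  assumes "finite S"
  shows "(\<Sum>\<rho> | \<rho> \<in> rank_maps K (Suc k) S \<and> bottom_size S \<rho> = Suc i. 2 ^ card (rank_steps S \<rho>)) =
         layer_count K k i (card S)"
  using assms
proof (induction k arbitrary: S i)
  case 0
  have bot: "bottom_size S (restrict (\<lambda>_. 0) S) = card S"
    unfolding bottom_size_def by (rule arg_cong[of _ _ card]) auto
  have "{\<rho> \<in> rank_maps K (Suc 0) S. bottom_size S \<rho> = Suc i} =
      (if i \<in> K \<and> card S = Suc i then {restrict (\<lambda>_. 0) S} else {})"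
    using bot by (auto simp: rank_maps_Suc_0[OF 0])
  moreover have "rank_steps S (restrict (\<lambda>_. 0) S) = {}"
    by (auto simp: rank_steps_def)
  ultimately show ?case
    by (simp del: restrict_apply)
next
  case (Suc k)
  show ?case
  proof (cases "i \<in> K")
    case True
    let ?\<A> = "{A. A \<subseteq> S \<and> card A = Suc i}"
    let ?w = "\<lambda>T \<tau>. 2 ^ card (rank_steps T \<tau>) :: nat"
    have "(\<Sum>\<rho> | \<rho> \<in> rank_maps K (Suc (Suc k)) S \<and> bottom_size S \<rho> = Suc i. ?w S \<rho>) =
          (\<Sum>(A, \<tau>)\<in>(SIGMA A:?\<A>. rank_maps K (Suc k) (S - A)). ?w S (add_bottom S A \<tau>))"
      using sum.reindex_bij_betw[OF bij_betw_add_bottom[OF True Suc.prems, of k], of "?w S", symmetric]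
      by (simp only: split_def)
    also have "\<dots> = (\<Sum>A\<in>?\<A>. \<Sum>\<tau>\<in>rank_maps K (Suc k) (S - A). ?w S (add_bottom S A \<tau>))"
      using Suc.prems by (intro sum.Sigma[symmetric]) (auto intro: finite_rank_maps)
    also have "\<dots> = (\<Sum>A\<in>?\<A>. \<Sum>j\<le>card S. psi_w (Suc i) (Suc j) * layer_count K k j (card S - Suc i))"
    proof (rule sum.cong[OF refl])
      fix A
      assume A: "A \<in> ?\<A>"
      then have finA: "finite A"
        by (auto intro: finite_subset[OF _ Suc.prems])
      have card: "card (S - A) = card S - Suc i"
        using A card_Diff_subset[OF finA, of S] by auto
      have "(\<Sum>\<tau>\<in>rank_maps K (Suc k) (S - A). ?w S (add_bottom S A \<tau>)) =
            (\<Sum>\<tau>\<in>rank_maps K (Suc k) (S - A). 2 ^ (Suc i * bottom_size (S - A) \<tau>) * ?w (S - A) \<tau>)"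
        using A Suc.prems by (intro sum.cong) (simp_all add: card_rank_steps_add_bottom power_add)
      also have "\<dots> = (\<Sum>j\<le>card S. \<Sum>\<tau> | \<tau> \<in> rank_maps K (Suc k) (S - A) \<and> bottom_size (S - A) \<tau> = Suc j.
            2 ^ (Suc i * bottom_size (S - A) \<tau>) * ?w (S - A) \<tau>)"
        using Suc.prems card by (intro sum_rank_maps_bottom) auto
      also have "\<dots> = (\<Sum>j\<le>card S. psi_w (Suc i) (Suc j) *
          (\<Sum>\<tau> | \<tau> \<in> rank_maps K (Suc k) (S - A) \<and> bottom_size (S - A) \<tau> = Suc j. ?w (S - A) \<tau>))"
        unfolding sum_distrib_left by (intro sum.cong) (auto simp: psi_w_def)
      also have "\<dots> = (\<Sum>j\<le>card S. psi_w (Suc i) (Suc j) * layer_count K k j (card S - Suc i))"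
        using Suc.prems by (simp add: Suc.IH card)
      finally show "(\<Sum>\<tau>\<in>rank_maps K (Suc k) (S - A). ?w S (add_bottom S A \<tau>)) =
          (\<Sum>j\<le>card S. psi_w (Suc i) (Suc j) * layer_count K k j (card S - Suc i))" .
    qed
    \<comment> \<open>If \<open>Suc i\<close> exceeds \<open>card S\<close>, there is no such
      \<open>A\<close>, in accordance with the value 0 of \<open>layer_count\<close>.\<close>
    also have "\<dots> = layer_count K (Suc k) i (card S)"
      using True Suc.prems by (auto simp: n_subsets binomial_eq_0 simp del: binomial_Suc_Suc)
    finally show ?thesis .
  next
    case False
    then have "{\<rho> \<in> rank_maps K (Suc (Suc k)) S. bottom_size S \<rho> = Suc i} = {}"
      by (auto dest!: bottom_size_range[OF _ Suc.prems])
    then show ?thesis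
      using False by (auto simp del: Collect_empty_eq)
  qed
qed

lemma structures_eq:
  assumes "finite S"
  shows "structures K (Suc k) S = (\<Sum>i\<le>card S. layer_count K k i (card S))"
  unfolding structures_def using assms
  by (simp add: sum_rank_maps_bottom[OF _ order_refl] structures_bottom)

section \<open>Numbers of weakly graded posets as sums of layer counts\<close>

lemma card_wg_posets:
  assumes "finite S" "\<forall>k\<in>H. k \<ge> 1" "finite H"
  shows "card {P \<in> wg_posets S. (\<exists>k\<in>H. has_height S k P) \<and> allowed_ranks K S P} =
         (\<Sum>k\<in>H. structures K k S)"
proof -
  have "card {P \<in> wg_posets S. (\<exists>k\<in>H. has_height S k P) \<and> allowed_ranks K S P} =
        card (SIGMA \<rho>:(\<Union>k\<in>H. rank_maps K k S). Pow (rank_steps S \<rho>))"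
    using bij_betw_same_card[OF bij_betw_wg_posets[OF assms(1,2), of K]] by simp
  also have "\<dots> = (\<Sum>\<rho>\<in>(\<Union>k\<in>H. rank_maps K k S). 2 ^ card (rank_steps S \<rho>))"
    using assms by (subst card_SigmaI) (auto simp: finite_rank_maps finite_rank_steps card_Pow)
  also have "\<dots> = (\<Sum>k\<in>H. structures K k S)"
    unfolding structures_def using assms
    by (intro sum.UNION_disjoint ballI impI finite_rank_maps rank_maps_disjoint)
  finally show ?thesis .
qed

text \<open>Pigeonhole; it turns the unbounded quantifier over heights into a finite one.\<close>

lemma has_height_le_card:
  fixes S :: "'a set"
  assumes "finite S" "has_height S k P"
  shows "k \<le> card S"
proof -
  obtain \<rho> :: "'a \<Rightarrow> int" where "\<rho> ` S = {0..<int k}"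
    using assms(2) by (auto simp: has_height_def)
  then show ?thesis
    using card_image_le[OF assms(1), of \<rho>] by simp
qed

lemma card_wg_posets_height:
  assumes "finite S" "k \<ge> 1"
  shows "card {P \<in> wg_posets S. has_height S k P \<and> allowed_ranks K S P} =
         (\<Sum>i\<le>card S. layer_count K (k - 1) i (card S))"
proof -
  have "{P \<in> wg_posets S. has_height S k P \<and> allowed_ranks K S P} =
      {P \<in> wg_posets S. (\<exists>k\<in>{k}. has_height S k P) \<and> allowed_ranks K S P}"
    by blast
  then have "card {P \<in> wg_posets S. has_height S k P \<and> allowed_ranks K S P} = structures K k S"
    using card_wg_posets[OF assms(1), of "{k}" K] assms(2) by simp
  then show ?thesis
    using structures_eq[OF assms(1), of K "k - 1"] assms(2) by simp
qed

lemma card_wg_posets_all: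
  assumes "finite S"
  shows "card {P \<in> wg_posets S. (\<exists>k\<ge>1. has_height S k P) \<and> allowed_ranks K S P} =
         (\<Sum>k\<le>card S. \<Sum>i\<le>card S. layer_count K k i (card S))"
proof -
  \<comment> \<open>The range includes the height \<open>card S + 1\<close>, which is never
    attained, so that the height minus one runs up to \<open>card S\<close> as in the generating
    function.\<close>
  have "(\<exists>k\<ge>1. has_height S k P) \<longleftrightarrow> (\<exists>k\<in>Suc ` {..card S}. has_height S k P)" for P
  proof
    assume "\<exists>k\<ge>1. has_height S k P"
    then obtain k where k: "k \<ge> 1" "has_height S k P" by blast
    then have "k - 1 \<in> {..card S}" "k = Suc (k - 1)"
      using has_height_le_card[OF assms, of k P] by auto
    then have "k \<in> Suc ` {..card S}"
      by (rule rev_image_eqI)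
    with k(2) show "\<exists>k\<in>Suc ` {..card S}. has_height S k P"
      by blast
  next
    assume "\<exists>k\<in>Suc ` {..card S}. has_height S k P"
    then obtain k where "has_height S (Suc k) P" by blast
    then show "\<exists>k\<ge>1. has_height S k P"
      by (intro exI[of _ "Suc k"]) simp
  qed
  then have "card {P \<in> wg_posets S. (\<exists>k\<ge>1. has_height S k P) \<and> allowed_ranks K S P} =
        card {P \<in> wg_posets S. (\<exists>k\<in>Suc ` {..card S}. has_height S k P) \<and> allowed_ranks K S P}"
    by (simp only:)
  also have "\<dots> = (\<Sum>k\<in>Suc ` {..card S}. structures K k S)"
    by (rule card_wg_posets[OF assms]) auto
  also have "\<dots> = (\<Sum>k\<le>card S. \<Sum>i\<le>card S. layer_count K k i (card S))"
    by (simp add: structures_eq[OF assms] sum.reindex)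
  finally show ?thesis .
qed

lemma ranks_at_most_iff: "ranks_at_most S r P \<longleftrightarrow> allowed_ranks {..<r} S P"
proof -
  have "insert 0 (Suc ` {..<r}) = {..r}"
    using lessThan_Suc_eq_insert_0[of r] lessThan_Suc_atMost[of r] by (rule trans[OF sym])
  then show ?thesis
    by (simp add: ranks_at_most_def allowed_ranks_def)
qed

lemma allowed_ranks_UNIV: "allowed_ranks UNIV S P"
proof -
  have "n \<in> insert 0 (range Suc)" for n :: nat
    by (cases n) auto
  then show ?thesis
    unfolding allowed_ranks_def by blast
qed

lemma num_height_bounded_eq:
  "k \<ge> 1 \<Longrightarrow> num_height_bounded r k n = (\<Sum>i\<le>n. layer_count {..<r} (k - 1) i n)"
  unfolding num_height_bounded_def ranks_at_most_iff
  using card_wg_posets_height[of "{1..n}" k "{..<r}"]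
  by (simp only: card_atLeastAtMost diff_Suc_1 finite_atLeastAtMost)

lemma num_bounded_eq: "num_bounded r n = (\<Sum>k\<le>n. \<Sum>i\<le>n. layer_count {..<r} k i n)"
  unfolding num_bounded_def ranks_at_most_iff
  using card_wg_posets_all[of "{1..n}" "{..<r}"]
  by (simp only: card_atLeastAtMost diff_Suc_1 finite_atLeastAtMost)

lemma num_all_eq: "num_all n = (\<Sum>k\<le>n. \<Sum>i\<le>n. layer_count UNIV k i n)"
  unfolding num_all_def using card_wg_posets_all[of "{1..n}" UNIV]
  by (simp only: card_atLeastAtMost diff_Suc_1 finite_atLeastAtMost allowed_ranks_UNIV simp_thms)

theorem theorem3p2:
  shows "(\<forall>r\<ge>1.
            (\<forall>k\<ge>1. egf_x (num_height_bounded r k) =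
                V_fin r \<bullet> (((D_fin r * A_fin r * D_fin r) ^\<^sub>m (k - 1)) *\<^sub>v V_fin r)) \<and>
            invertible_mat (1\<^sub>m r - D_fin r * A_fin r * D_fin r) \<and>
            egf_x (num_bounded r) =
              V_fin r \<bullet> (mat_inv_of (1\<^sub>m r - D_fin r * A_fin r * D_fin r) *\<^sub>v V_fin r))
       \<and> (let B = inf_inv (inf_minus inf_one (inf_mult (inf_mult D_inf A_inf) D_inf)) in
            (\<exists>!C. inf_inverse_of (inf_minus inf_one (inf_mult (inf_mult D_inf A_inf) D_inf)) C) \<and>
            (\<forall>i. summable (\<lambda>j. B i j * V_inf j)) \<and>
            (\<lambda>i. V_inf i * inf_mult_vec B V_inf i) sums egf_x num_all)"
proof -
  have num_height: "num_height_bounded r k = (\<lambda>n. \<Sum>i\<le>n. layer_count {..<r} (k - 1) i n)"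
    if "k \<ge> 1" for r k
    using that by (simp only: fun_eq_iff num_height_bounded_eq simp_thms)
  have num_bounded: "num_bounded r = (\<lambda>n. \<Sum>k\<le>n. \<Sum>i\<le>n. layer_count {..<r} k i n)" for r
    by (rule ext) (rule num_bounded_eq)
  have num_all: "num_all = (\<lambda>n. \<Sum>k\<le>n. \<Sum>i\<le>n. layer_count UNIV k i n)"
    by (rule ext) (rule num_all_eq)
  \<comment> \<open>\<open>inf_inverse_of\<close> holds for \<open>res UNIV\<close> and nothing
    else, which settles both the definite description and the claim of unique existence.\<close>
  have inv: "inf_inv (inf_minus inf_one (inf_mult (inf_mult D_inf A_inf) D_inf)) = res UNIV"
    unfolding inf_inv_def inf_inverse_DAD_iff by (rule the_eq_trivial)
  have "summable (\<lambda>j. res UNIV i j * V_inf j)" for i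
    unfolding V_inf_eq by (intro null_family_summable null_family_mult_left null_weight)
  moreover have "(\<lambda>i. V_inf i * inf_mult_vec (res UNIV) V_inf i) sums egf_x num_all"
    unfolding res_V_inf unfolding V_inf_eq num_all by (rule weight_sol_sums)
  ultimately show ?thesis
    unfolding Let_def inv inf_inverse_DAD_iff V_fin_pow V_fin_inverse
    by (auto simp: num_height num_bounded invertible_fin)
qed

end
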